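(* Let $\beta\in\mathbb R$, let $A\in C_c^\infty(\mathbb R;\mathbb C)$, and let $K\subset\mathbb R$ be compact with $\operatorname{supp}A\subset\operatorname{int}K$. For every integer $N\ge1$ there exists $$U_N=U_0+\sum_{k=1}^N\phi_k,\qquad \phi_k\in\mathcal H_k(K),$$ such that for every integer $m\ge0$ there are constants $C^{(0)}_{N,m}>0$ and $\mathfrak d^{(0)}_{N,m}\in\mathbb N_0$ for which $$\|\partial_\xi^m\mathfrak R_0(U_N)(s)\|_2\le C^{(0)}_{N,m}s^{-N-2}(1+\log s)^{\mathfrak d^{(0)}_{N,m}},\qquad s\ge1 .$$ The corrections $\phi_1,\dots,\phi_N$ are determined by $\beta$ and $A$ alone; they are independent of $\gamma$ and $\mathcal W$ and coincide with the coefficients for $\mathcal W\equiv0$. The constants in this estimate depend only on $N,m,\beta,A,K$. Assume in addition that $\gamma\in\mathbb R$, $\operatorname{dist}(K,\{-\gamma\})>0$, and that $\mathcal W$ satisfies the assumption of the context with exponent $p>2$. Then there are constants $C_{N,m}>0$ and $\mathfrak d_{N,m}\in\mathbb N_0$ such that $$\|\partial_\xi^m\mathfrak R(U_N)(s)\|_2\le C_{N,m}\big[s^{-N-2}+s^{-p-2}\big](1+\log s)^{\mathfrak d_{N,m}},\qquad s\ge1,$$ where the constants may also depend on $\gamma$, $\mathcal W$ and the decay parameters of $\mathcal W$. If $\mathcal W\in\mathcal S(\mathbb R)$, then for every prescribed $p_*>0$ the second term $s^{-p-2}(1+\log s)^{\mathfrak d_{N,m}}$ may be replaced by $s^{-p_*-2}(1+\log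 s)^{\mathfrak d_{N,m}}$, with the constant allowed to depend on $p_*$ and on finitely many Schwartz seminorms of $\mathcal W$.
   Context: Notation: $\langle x\rangle=(1+x^2)^{1/2}$; $\|\cdot\|_2$ is the $L^2(\mathbb R)$ norm in $\xi$; $\mathbb N_0=\{0,1,2,\dots\}$; $\mathcal S(\mathbb R)$ is the Schwartz class. Assumption on $\mathcal W$: $\mathcal W:\mathbb R\to\mathbb R$ is smooth and there exist $p>2$ and constants $C_{\mathcal W,j}>0$ such that $|\partial_x^j\mathcal W(x)|\le C_{\mathcal W,j}\langle x\rangle^{-p-j}$ for all $x\in\mathbb R$ and all integers $j\ge0$. For $s\ge1$, $\xi\in\mathbb R$: $\omega_A(s,\xi)=e^{-i\beta|A(\xi)|^2\log s}$ and $U_0(s,\xi)=\omega_A(s,\xi)A(\xi)$. For integers $k\ge1$, $$\mathcal H_k(K)=\Big\{\omega_A(s,\xi)s^{-k}\sum_{j=0}^Jc_j(\xi)(\log s)^j:\ J\in\mathbb N_0,\ c_j\in C_c^\infty(\mathbb R;\mathbb C),\ \operatorname{supp}c_j\subset K\Big\}.$$ The residual operators are $$\mathfrak R_0(U)=i\partial_sU+s^{-2}\partial_\xi^2U-\beta s^{-1}|U|^2U,\qquad \mathfrak R(U)=\mathfrak R_0(U)+s^{-2}\mathcal W\big(s(\xi+\gamma)\big)|U|^4U .$$ *)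

theory Defs
  imports "HOL-Analysis.Analysis"
begin

section \<open>Smooth functions on the real line\<close>

definition nth_deriv :: "nat \<Rightarrow> (real \<Rightarrow> 'a::real_normed_vector) \<Rightarrow> real \<Rightarrow> 'a" where
  "nth_deriv m f = ((\<lambda>g x. vector_derivative g (at x)) ^^ m) f"

definition smooth :: "(real \<Rightarrow> 'a::real_normed_vector) \<Rightarrow> bool" where
  "smooth f \<longleftrightarrow> (\<forall>m x. nth_deriv m f differentiable (at x))"

definition tsupp :: "(real \<Rightarrow> 'a::real_normed_vector) \<Rightarrow> real set" where
  "tsupp f = closure {x. f x \<noteq> 0}"

definition test_functions :: "(real \<Rightarrow> complex) set" where
  "test_functions = {f. smooth f \<and> compact (tsupp f)}"

section \<open>The $L^2$ norm\<close>

definition square_integrable :: "(real \<Rightarrow> complex) \<Rightarrow> bool" where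
  "square_integrable f \<longleftrightarrow>
     f \<in> borel_measurable lborel \<and> integrable lborel (\<lambda>x. (cmod (f x))\<^sup>2)"

definition L2_norm :: "(real \<Rightarrow> complex) \<Rightarrow> real" where
  "L2_norm f = sqrt (LINT x|lborel. (cmod (f x))\<^sup>2)"

text \<open>The Bochner integral of a non-integrable function is \<open>0\<close>, so a bound on the
  \<open>L2_norm\<close> is meaningful only together with square integrability.\<close>

definition L2_bounded :: "(real \<Rightarrow> complex) \<Rightarrow> real \<Rightarrow> bool" where
  "L2_bounded f B \<longleftrightarrow> square_integrable f \<and> L2_norm f \<le> B"

section \<open>Potentials\<close>

definition japanese :: "real \<Rightarrow> real" where
  "japanese x = sqrt (1 + x\<^sup>2)"

definition decaying_potential :: "real \<Rightarrow> (real \<Rightarrow> real) \<Rightarrow> bool" where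
  "decaying_potential p W \<longleftrightarrow> p > 2 \<and> smooth W \<and>
     (\<forall>j. \<exists>C>0. \<forall>x. \<bar>nth_deriv j W x\<bar> \<le> C * japanese x powr (- p - real j))"

definition schwartz :: "(real \<Rightarrow> real) \<Rightarrow> bool" where
  "schwartz W \<longleftrightarrow> smooth W \<and> (\<forall>a b. bounded (range (\<lambda>x. x ^ a * nth_deriv b W x)))"

definition schwartz_seminorm :: "(real \<Rightarrow> real) \<Rightarrow> nat \<times> nat \<Rightarrow> real" where
  "schwartz_seminorm W = (\<lambda>(a, b). SUP x. \<bar>x ^ a * nth_deriv b W x\<bar>)"

section \<open>Approximate solutions and residuals\<close>

text \<open>Functions of \<open>(s, \<xi>)\<close> are curried, with \<open>s\<close> first; only their values for
  \<open>s \<ge> 1\<close> matter.\<close>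

definition phase :: "real \<Rightarrow> (real \<Rightarrow> complex) \<Rightarrow> real \<Rightarrow> real \<Rightarrow> complex" where
  "phase \<beta> A s \<xi> = exp (- \<i> * of_real (\<beta> * (cmod (A \<xi>))\<^sup>2 * ln s))"

definition leading :: "real \<Rightarrow> (real \<Rightarrow> complex) \<Rightarrow> real \<Rightarrow> real \<Rightarrow> complex" where
  "leading \<beta> A s \<xi> = phase \<beta> A s \<xi> * A \<xi>"

definition corrections ::
    "real \<Rightarrow> (real \<Rightarrow> complex) \<Rightarrow> real set \<Rightarrow> nat \<Rightarrow> (real \<Rightarrow> real \<Rightarrow> complex) set" where
  "corrections \<beta> A K k =
     {\<lambda>s \<xi>. phase \<beta> A s \<xi> * of_real (1 / s ^ k) * (\<Sum>j=0..J. c j \<xi> * of_real (ln s ^ j)) | J c.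
        \<forall>j\<le>J. c j \<in> test_functions \<and> tsupp (c j) \<subseteq> K}"

definition approx ::
    "real \<Rightarrow> (real \<Rightarrow> complex) \<Rightarrow> (nat \<Rightarrow> real \<Rightarrow> real \<Rightarrow> complex) \<Rightarrow> nat \<Rightarrow>
     real \<Rightarrow> real \<Rightarrow> complex" where
  "approx \<beta> A \<phi> N s \<xi> = leading \<beta> A s \<xi> + (\<Sum>k=1..N. \<phi> k s \<xi>)"

text \<open>The time derivative is taken within \<open>[1, \<infinity>)\<close>, hence one-sided at \<open>s = 1\<close>.\<close>

definition residual0 :: "real \<Rightarrow> (real \<Rightarrow> real \<Rightarrow> complex) \<Rightarrow> real \<Rightarrow> real \<Rightarrow> complex" where
  "residual0 \<beta> U s \<xi> =
     \<i> * vector_derivative (\<lambda>r. U r \<xi>) (at s within {1..})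
     + of_real (1 / s\<^sup>2) * nth_deriv 2 (U s) \<xi>
     - of_real (\<beta> / s * (cmod (U s \<xi>))\<^sup>2) * U s \<xi>"

definition residual ::
    "real \<Rightarrow> real \<Rightarrow> (real \<Rightarrow> real) \<Rightarrow> (real \<Rightarrow> real \<Rightarrow> complex) \<Rightarrow> real \<Rightarrow> real \<Rightarrow> complex" where
  "residual \<beta> \<gamma> W U s \<xi> =
     residual0 \<beta> U s \<xi> + of_real (1 / s\<^sup>2 * W (s * (\<xi> + \<gamma>)) * (cmod (U s \<xi>)) ^ 4) * U s \<xi>"

text \<open>Positive distance between \<open>K\<close> and the point \<open>x\<close>. The library's \<open>setdist\<close> is \<open>0\<close> if one
  of the sets is empty, whereas the infimum over the empty set is \<open>\<infinity>\<close>.\<close>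

definition separated :: "real set \<Rightarrow> real \<Rightarrow> bool" where
  "separated K x \<longleftrightarrow> K = {} \<or> setdist K {x} > 0"

end

theory Submission
  imports Defs
begin

text \<open>
  Write \<open>U = \<omega> V\<close> with the phase \<open>\<omega> = exp (- i \<beta> |A|\<^sup>2 log s)\<close>. The phase factors out of the residual and leaves
  \<open>i \<partial>\<^sub>s V + \<beta> s^(-1) (|A|\<^sup>2 - |V|\<^sup>2) V + s^(-2) D\<^sup>2 V\<close>, where \<open>D = \<partial>\<^sub>\<xi> - i \<beta> log s (|A|\<^sup>2)'\<close>. Everything happens in the ring
  \<open>expansions\<close> of finite sums of terms \<open>c(\<xi>) s^(-k) log^j s\<close>, filtered by the least \<open>k\<close>: \<open>\<partial>\<^sub>s\<close> raises the level by
  one, \<open>D\<close> preserves it, and products add levels.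

  For \<open>V = A\<close> the residual has level \<open>2\<close>. If it has level \<open>n + 1\<close>, a correction \<open>s^(-n) P(log s, \<xi>)\<close> removes its leading
  part exactly when \<open>P\<close> solves the linear equation \<open>\<partial>\<^sub>l P = n P + M P + i G\<close>, where
  \<open>M P = - i \<beta> (|A|\<^sup>2 P + A\<^sup>2 cnj P)\<close> and \<open>G\<close> is the leading coefficient (\<open>improve_approximation\<close>). The operator \<open>M\<close>
  satisfies \<open>M\<^sup>2 = 0\<close>, so \<open>n + M\<close> is inverted by \<open>n^(-1) - n^(-2) M\<close> without dividing by \<open>A\<close>, and there is a solution
  that is polynomial in \<open>l = log s\<close> with smooth coefficients supported in the support of \<open>A\<close>
  (\<open>transport_solvable\<close>). Iterating gives one sequence of corrections, determined by \<open>\<beta>\<close> and \<open>A\<close>, whose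
  partial sums up to \<open>N\<close> have residual of level \<open>N + 2\<close> (\<open>approximate_solutions\<close>).

  Since \<open>D\<close> preserves levels, \<open>\<xi>\<close>-derivatives of the residual are bounded by \<open>s^(-N-2)\<close> times a power of
  \<open>1 + log s\<close>, uniformly on a compact support, and the \<open>L\<^sup>2\<close> bound follows. In the term with the potential,
  \<open>\<xi>\<close>-derivatives that fall on \<open>W (s (\<xi> + \<gamma>))\<close> produce powers \<open>s^a\<close>. On the support \<open>|s (\<xi> + \<gamma>)| \<ge> s \<delta>\<close> for some
  \<open>\<delta> > 0\<close>, so that the decay of the \<open>a\<close>-th derivative of \<open>W\<close> pays for \<open>s^a\<close> and leaves \<open>s^(-p)\<close>, or any power of
  \<open>s^(-1)\<close> for a Schwartz potential (\<open>residual_bound\<close>).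
\<close>

section \<open>Smooth functions\<close>

lemma nth_deriv_0 [simp]: "nth_deriv 0 f = f"
  by (simp add: nth_deriv_def)

lemma nth_deriv_Suc: "nth_deriv (Suc m) f = (\<lambda>x. vector_derivative (nth_deriv m f) (at x))"
  by (simp add: nth_deriv_def)

lemma nth_deriv_add: "nth_deriv m (nth_deriv k f) = nth_deriv (m + k) f"
  by (simp add: nth_deriv_def funpow_add)

lemma nth_deriv_of_sequence:
  assumes "\<And>i x. (F i has_vector_derivative F (Suc i) x) (at x)"
  shows "nth_deriv m (F 0) = F m"
  by (induction m) (auto simp: nth_deriv_Suc intro!: ext vector_derivative_at assms)

text \<open>A class of functions that is closed under differentiation consists of smooth functions.
  This replaces inductions on the order of differentiability below.\<close>

lemma smooth_coinduct:
  assumes "X f"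
    and "\<And>g. X g \<Longrightarrow> \<exists>g'. X g' \<and> (\<forall>x. (g has_vector_derivative g' x) (at x))"
  shows "smooth f"
proof -
  have "X (nth_deriv m f)" for m
  proof (induction m)
    case (Suc m)
    from assms(2)[OF this] obtain g' where
      g': "X g'" "\<And>x. (nth_deriv m f has_vector_derivative g' x) (at x)"
      by blast
    have "nth_deriv (Suc m) f = g'"
      unfolding nth_deriv_Suc by (intro ext vector_derivative_at g')
    then show ?case using g' by simp
  qed (simp add: assms)
  with assms(2) show ?thesis
    unfolding smooth_def by (meson differentiableI_vector)
qed

lemma smooth_nth_deriv: "smooth f \<Longrightarrow> smooth (nth_deriv k f)"
  by (simp add: smooth_def nth_deriv_add)

lemma smooth_has_nth_deriv:
  assumes "smooth f"
  shows "(nth_deriv k f has_vector_derivative nth_deriv (Suc k) f x) (at x)"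
  using assms unfolding smooth_def nth_deriv_Suc by (simp add: vector_derivative_works)

lemma smooth_has_deriv:
  assumes "smooth f"
  shows "(f has_vector_derivative nth_deriv 1 f x) (at x)"
  using smooth_has_nth_deriv[OF assms, of 0] by simp

lemma smooth_const: "smooth (\<lambda>x. c)"
  by (rule smooth_coinduct[where X = "\<lambda>g. \<exists>c. g = (\<lambda>x. c)"])
     (auto intro!: derivative_eq_intros)

text \<open>The Leibniz rule leaves the class of products of smooth functions, but not the algebra
  generated by all smooth functions and their conjugates. That algebra is closed under
  differentiation, so the coinduction principle applies to it, and it yields sums, products and
  conjugates of smooth functions all at once.\<close>

inductive smooth_generated :: "(real \<Rightarrow> complex) \<Rightarrow> bool" where
  gen: "smooth f \<Longrightarrow> smooth_generated f"
| add: "smooth_generated f \<Longrightarrow> smooth_generated g \<Longrightarrow> smooth_generated (\<lambda>x. f x + g x)"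
| mult: "smooth_generated f \<Longrightarrow> smooth_generated g \<Longrightarrow> smooth_generated (\<lambda>x. f x * g x)"
| cnj: "smooth_generated f \<Longrightarrow> smooth_generated (\<lambda>x. cnj (f x))"

lemma smooth_generated_imp_smooth:
  assumes "smooth_generated f"
  shows "smooth f"
proof (rule smooth_coinduct[of smooth_generated, OF assms])
  fix g assume "smooth_generated g"
  then show "\<exists>g'. smooth_generated g' \<and> (\<forall>x. (g has_vector_derivative g' x) (at x))"
  proof induction
    case (gen f)
    then show ?case
      using smooth_has_deriv smooth_nth_deriv smooth_generated.gen by blast
  next
    case (add f g)
    then obtain f' g' where "smooth_generated f'" "\<And>x. (f has_vector_derivative f' x) (at x)"
      "smooth_generated g'" "\<And>x. (g has_vector_derivative g' x) (at x)" by blast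
    then show ?case
      by (intro exI[of _ "\<lambda>x. f' x + g' x"])
         (auto intro: smooth_generated.add has_vector_derivative_add)
  next
    case (mult f g)
    then obtain f' g' where "smooth_generated f'" "\<And>x. (f has_vector_derivative f' x) (at x)"
      "smooth_generated g'" "\<And>x. (g has_vector_derivative g' x) (at x)" by blast
    with mult.hyps show ?case
      by (intro exI[of _ "\<lambda>x. f x * g' x + f' x * g x"])
         (auto intro: smooth_generated.intros has_vector_derivative_mult)
  next
    case (cnj f)
    then obtain f' where "smooth_generated f'" "\<And>x. (f has_vector_derivative f' x) (at x)"
      by blast
    then show ?case
      by (intro exI[of _ "\<lambda>x. cnj (f' x)"])
         (auto intro: smooth_generated.intros has_vector_derivative_cnj)
  qed
qed

lemmas smooth_add = smooth_generated_imp_smooth[OF smooth_generated.add[OF smooth_generated.gen smooth_generated.gen]]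
  and smooth_mult = smooth_generated_imp_smooth[OF smooth_generated.mult[OF smooth_generated.gen smooth_generated.gen]]
  and smooth_cnj = smooth_generated_imp_smooth[OF smooth_generated.cnj[OF smooth_generated.gen]]

text \<open>Prescribing a common zero set, rather than the support of each function, makes these functions
  a ring; for compact \<open>S\<close> they are test functions.\<close>

definition supported_smooth :: "real set \<Rightarrow> (real \<Rightarrow> complex) set" where
  "supported_smooth S = {c. smooth c \<and> (\<forall>x. x \<notin> S \<longrightarrow> c x = 0)}"

lemma supported_smooth_add:
  "f \<in> supported_smooth S \<Longrightarrow> g \<in> supported_smooth S \<Longrightarrow> (\<lambda>x. f x + g x) \<in> supported_smooth S"
  by (simp add: supported_smooth_def smooth_add)

lemma supported_smooth_mult:
  "f \<in> supported_smooth S \<Longrightarrow> g \<in> supported_smooth S \<Longrightarrow> (\<lambda>x. f x * g x) \<in> supported_smooth S"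
  by (simp add: supported_smooth_def smooth_mult)

lemma supported_smooth_cmult:
  "f \<in> supported_smooth S \<Longrightarrow> (\<lambda>x. a * f x) \<in> supported_smooth S"
  by (simp add: supported_smooth_def smooth_mult smooth_const)

lemma supported_smooth_cnj:
  "f \<in> supported_smooth S \<Longrightarrow> (\<lambda>x. cnj (f x)) \<in> supported_smooth S"
  by (simp add: supported_smooth_def smooth_cnj)

lemma supported_smooth_zero: "(\<lambda>x. 0) \<in> supported_smooth S"
  by (simp add: supported_smooth_def smooth_const)

lemma has_vector_derivative_zero_outside:
  fixes f :: "real \<Rightarrow> 'a::real_normed_vector"
  assumes "closed S" "\<And>x. x \<notin> S \<Longrightarrow> f x = 0" "x \<notin> S"
  shows "(f has_vector_derivative 0) (at x)"
  by (rule has_vector_derivative_transform_within_open[of "\<lambda>x. 0" 0 x "- S"])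
     (use assms in auto)

lemma supported_smooth_deriv:
  assumes "closed S" "f \<in> supported_smooth S"
  shows "nth_deriv 1 f \<in> supported_smooth S"
proof -
  have "nth_deriv 1 f x = 0" if "x \<notin> S" for x
    using has_vector_derivative_zero_outside[OF assms(1) _ that, of f] assms(2)
    by (simp add: supported_smooth_def nth_deriv_Suc vector_derivative_at)
  then show ?thesis
    using assms(2) by (simp add: supported_smooth_def smooth_nth_deriv)
qed

lemma smooth_continuous: "smooth f \<Longrightarrow> continuous_on UNIV f"
  by (rule continuous_at_imp_continuous_on)
     (auto intro: has_vector_derivative_continuous smooth_has_deriv)

lemma supported_smooth_bounded:
  assumes "compact S" "f \<in> supported_smooth S"
  obtains B where "B \<ge> 0" "\<And>x. cmod (f x) \<le> B"
proof -
  have "compact (f ` S)"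
    using assms smooth_continuous[of f] continuous_on_subset[of UNIV f S]
    by (intro compact_continuous_image) (auto simp: supported_smooth_def)
  then obtain B where B: "\<And>x. x \<in> S \<Longrightarrow> cmod (f x) \<le> B"
    by (meson bounded_iff compact_imp_bounded imageI)
  have "cmod (f x) \<le> max B 0" for x
    using B[of x] assms(2) by (cases "x \<in> S") (auto simp: supported_smooth_def)
  then show ?thesis using that[of "max B 0"] by simp
qed

lemma supported_smooth_imp_test_function:
  assumes "compact S" "f \<in> supported_smooth S"
  shows "f \<in> test_functions" "tsupp f \<subseteq> S"
proof -
  show sub: "tsupp f \<subseteq> S"
    unfolding tsupp_def using assms
    by (intro closure_minimal) (auto simp: supported_smooth_def compact_imp_closed)
  have "compact (tsupp f)"
    using compact_Int_closed[OF assms(1), of "tsupp f"] sub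
    by (simp add: tsupp_def Int_absorb1)
  then show "f \<in> test_functions"
    using assms(2) by (simp add: supported_smooth_def test_functions_def)
qed

lemma test_function_supported_smooth:
  "f \<in> test_functions \<Longrightarrow> f \<in> supported_smooth (tsupp f)"
  using closure_subset[of "{x. f x \<noteq> 0}"]
  by (auto simp: supported_smooth_def test_functions_def tsupp_def)

section \<open>The filtered ring of expansions in inverse powers and logarithms\<close>

lemma has_deriv_inverse_power:
  assumes "s > 0"
  shows "((\<lambda>r. 1 / r ^ n) has_real_derivative - real n / s ^ Suc n) (at s)"
proof (rule DERIV_cong)
  show "((\<lambda>r. 1 / r ^ n) has_real_derivative
      (0 * s ^ n - 1 * (real n * s ^ (n - Suc 0))) / (s ^ n * s ^ n)) (at s)"
    by (rule DERIV_divide[OF DERIV_const DERIV_pow]) (use assms in simp)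
  show "(0 * s ^ n - 1 * (real n * s ^ (n - Suc 0))) / (s ^ n * s ^ n) = - real n / s ^ Suc n"
    using assms by (cases n) (simp_all add: divide_simps)
qed

text \<open>Finite sums of terms \<open>c(\<xi>) s^(-k) log^j s\<close> with \<open>k \<ge> n\<close>. The sets decrease in \<open>n\<close> and form a filtered
  ring; a member of level \<open>n\<close> is of size \<open>s^(-n)\<close> up to logarithms. The rule \<open>cong\<close> identifies functions that agree
  for \<open>s > 0\<close>, which is where \<open>ln\<close> and the powers have their usual derivatives.\<close>

inductive_set expansions :: "real set \<Rightarrow> nat \<Rightarrow> (real \<Rightarrow> real \<Rightarrow> complex) set"
  for S :: "real set" and n :: nat where
  monomial: "c \<in> supported_smooth S \<Longrightarrow> n \<le> k \<Longrightarrow>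
    (\<lambda>s \<xi>. c \<xi> * of_real (1 / s ^ k) * of_real (ln s ^ j)) \<in> expansions S n"
| add: "f \<in> expansions S n \<Longrightarrow> g \<in> expansions S n \<Longrightarrow>
    (\<lambda>s \<xi>. f s \<xi> + g s \<xi>) \<in> expansions S n"
| cong: "f \<in> expansions S n \<Longrightarrow> (\<And>s \<xi>. s > 0 \<Longrightarrow> g s \<xi> = f s \<xi>) \<Longrightarrow> g \<in> expansions S n"

lemma expansions_mono:
  assumes "f \<in> expansions S n" "m \<le> n"
  shows "f \<in> expansions S m"
  using assms(1)
proof induction
  case (monomial c k j) then show ?case using assms(2) by (intro expansions.monomial) auto
next
  case add then show ?case by (intro expansions.add)
next
  case cong show ?case by (rule expansions.cong) (use cong in auto)
qed

lemma expansions_coefficient: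
  assumes "c \<in> supported_smooth S"
  shows "(\<lambda>s. c) \<in> expansions S 0"
  by (rule expansions.cong[OF expansions.monomial[OF assms, of 0 0 0]]) auto

lemma expansions_term_mult:
  assumes "f \<in> expansions S n" "c \<in> supported_smooth S"
  shows "(\<lambda>s \<xi>. c \<xi> * of_real (1 / s ^ k) * of_real (ln s ^ j) * f s \<xi>)
    \<in> expansions S (k + n)"
  using assms(1)
proof induction
  case (monomial c' k' j')
  have "(\<lambda>s \<xi>. (c \<xi> * c' \<xi>) * of_real (1 / s ^ (k + k')) * of_real (ln s ^ (j + j')))
      \<in> expansions S (k + n)"
    by (intro expansions.monomial supported_smooth_mult) (use assms monomial in auto)
  then show ?case by (rule expansions.cong) (simp add: power_add mult_ac)
next
  case (add f g)
  show ?case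
    by (rule expansions.cong[OF expansions.add[OF add.IH]]) (simp add: ring_distribs)
next
  case (cong f g)
  show ?case by (rule expansions.cong[OF cong.IH]) (simp add: cong)
qed

lemma expansions_mult:
  assumes "f \<in> expansions S m" "g \<in> expansions S n"
  shows "(\<lambda>s \<xi>. f s \<xi> * g s \<xi>) \<in> expansions S (m + n)"
  using assms(1)
proof induction
  case (monomial c k j)
  then show ?case
    using expansions_term_mult[OF assms(2) monomial(1), of k j] by (rule_tac expansions_mono) auto
next
  case (add f f')
  show ?case
    by (rule expansions.cong[OF expansions.add[OF add.IH]]) (simp add: ring_distribs)
next
  case (cong f f')
  show ?case by (rule expansions.cong[OF cong.IH]) (simp add: cong)
qed

lemma expansions_factor:
  assumes "f \<in> expansions S n"
  shows "(\<lambda>s \<xi>. a * of_real (1 / s ^ k) * of_real (ln s ^ j) * f s \<xi>) \<in> expansions S (k + n)"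
  using assms
proof induction
  case (monomial c' k' j')
  have "(\<lambda>s \<xi>. (a * c' \<xi>) * of_real (1 / s ^ (k + k')) * of_real (ln s ^ (j + j')))
      \<in> expansions S (k + n)"
    by (intro expansions.monomial supported_smooth_cmult) (use assms monomial in auto)
  then show ?case by (rule expansions.cong) (simp add: power_add mult_ac)
next
  case (add f g)
  show ?case
    by (rule expansions.cong[OF expansions.add[OF add.IH]]) (simp add: ring_distribs)
next
  case (cong f g)
  show ?case by (rule expansions.cong[OF cong.IH]) (simp add: cong)
qed

lemma expansions_cmult:
  assumes "f \<in> expansions S n"
  shows "(\<lambda>s \<xi>. a * f s \<xi>) \<in> expansions S n"
  using expansions_factor[OF assms, of a 0 0] by simp

lemma expansions_diff:
  assumes "f \<in> expansions S n" "g \<in> expansions S n"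
  shows "(\<lambda>s \<xi>. f s \<xi> - g s \<xi>) \<in> expansions S n"
  using expansions.add[OF assms(1) expansions_cmult[OF assms(2), of "-1"]] by simp

lemma expansions_zero: "(\<lambda>s \<xi>. 0) \<in> expansions S n"
  by (rule expansions.cong[OF expansions.monomial[OF supported_smooth_zero order_refl, where j = 0]]) simp

lemma expansions_cnj:
  assumes "f \<in> expansions S n"
  shows "(\<lambda>s \<xi>. cnj (f s \<xi>)) \<in> expansions S n"
  using assms
proof induction
  case (monomial c k j)
  show ?case
    using expansions.monomial[OF supported_smooth_cnj[OF monomial(1)] monomial(2), of j] by simp
next
  case (add f g)
  show ?case using expansions.add[OF add.IH] by simp
next
  case (cong f g)
  show ?case by (rule expansions.cong[OF cong.IH]) (simp add: cong)
qed

lemma expansions_outside: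
  assumes "f \<in> expansions S n" "s > 0" "\<xi> \<notin> S"
  shows "f s \<xi> = 0"
  using assms(1) by induction (use assms in \<open>auto simp: supported_smooth_def\<close>)

lemma expansions_space_deriv:
  assumes "f \<in> expansions S n" "closed S"
  shows "\<exists>f'\<in>expansions S n. \<forall>s>0. \<forall>\<xi>. (f s has_vector_derivative f' s \<xi>) (at \<xi>)"
  using assms(1)
proof induction
  case (monomial c k j)
  have "smooth c" using monomial by (simp add: supported_smooth_def)
  have "(\<lambda>s \<xi>. nth_deriv 1 c \<xi> * of_real (1 / s ^ k) * of_real (ln s ^ j)) \<in> expansions S n"
    by (intro expansions.monomial supported_smooth_deriv assms monomial)
  moreover have "((\<lambda>\<xi>. c \<xi> * of_real (1 / s ^ k) * of_real (ln s ^ j)) has_vector_derivative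
      nth_deriv 1 c \<xi> * of_real (1 / s ^ k) * of_real (ln s ^ j)) (at \<xi>)" for s \<xi>
    by (intro has_vector_derivative_mult_left smooth_has_deriv \<open>smooth c\<close>)
  ultimately show ?case by (intro bexI) auto
next
  case (add f g)
  then obtain f' g' where "f' \<in> expansions S n" "g' \<in> expansions S n"
    "\<forall>s>0. \<forall>\<xi>. (f s has_vector_derivative f' s \<xi>) (at \<xi>)"
    "\<forall>s>0. \<forall>\<xi>. (g s has_vector_derivative g' s \<xi>) (at \<xi>)" by blast
  then show ?case
    by (intro bexI[of _ "\<lambda>s \<xi>. f' s \<xi> + g' s \<xi>"])
       (auto intro: expansions.add has_vector_derivative_add)
next
  case (cong f g)
  have "g s = f s" if "s > 0" for s using cong(2)[OF that] by auto
  then show ?case using cong.IH by simp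
qed

text \<open>Differentiation in \<open>s\<close> gains one power of decay, on powers and on logarithms alike. A correction of
  level \<open>n\<close> is therefore felt by the equation at level \<open>n + 1\<close>.\<close>

lemma expansions_time_deriv:
  assumes "f \<in> expansions S n"
  shows "\<exists>f'\<in>expansions S (Suc n). \<forall>s>0. \<forall>\<xi>. ((\<lambda>r. f r \<xi>) has_vector_derivative f' s \<xi>) (at s)"
  using assms
proof induction
  case (monomial c k j)
  let ?g = "\<lambda>s \<xi>. (- of_nat k * c \<xi>) * of_real (1 / s ^ Suc k) * of_real (ln s ^ j)
      + (of_nat j * c \<xi>) * of_real (1 / s ^ Suc k) * of_real (ln s ^ (j - 1))"
  have g: "?g \<in> expansions S (Suc n)"
    by (intro expansions.add expansions.monomial supported_smooth_cmult) (use monomial in auto)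
  have "((\<lambda>r. c \<xi> * of_real (1 / r ^ k) * of_real (ln r ^ j)) has_vector_derivative ?g s \<xi>) (at s)"
    if "s > 0" for s \<xi>
  proof -
    note has_deriv_inverse_power[OF that, of k]
    moreover have "((\<lambda>r. ln r ^ j) has_real_derivative real j * ln s ^ (j - 1) * (1 / s)) (at s)"
      using that by (auto intro!: derivative_eq_intros)
    ultimately have "((\<lambda>r. 1 / r ^ k * ln r ^ j) has_real_derivative
        (- real k / s ^ Suc k * ln s ^ j + real j / s ^ Suc k * ln s ^ (j - 1))) (at s)"
      by (rule DERIV_cong[OF DERIV_mult]) simp
    then have "((\<lambda>r. c \<xi> * of_real (1 / r ^ k * ln r ^ j)) has_vector_derivative
       c \<xi> * of_real (- real k / s ^ Suc k * ln s ^ j + real j / s ^ Suc k * ln s ^ (j - 1))) (at s)"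
      by (intro has_vector_derivative_mult_right has_vector_derivative_of_real)
         (simp add: has_real_derivative_iff_has_vector_derivative)
    then show ?thesis by (simp add: algebra_simps)
  qed
  with g show ?case by (intro bexI[of _ ?g]) auto
next
  case (add f g)
  then obtain f' g' where "f' \<in> expansions S (Suc n)" "g' \<in> expansions S (Suc n)"
    "\<forall>s>0. \<forall>\<xi>. ((\<lambda>r. f r \<xi>) has_vector_derivative f' s \<xi>) (at s)"
    "\<forall>s>0. \<forall>\<xi>. ((\<lambda>r. g r \<xi>) has_vector_derivative g' s \<xi>) (at s)" by blast
  then show ?case
    by (intro bexI[of _ "\<lambda>s \<xi>. f' s \<xi> + g' s \<xi>"])
       (auto intro: expansions.add has_vector_derivative_add)
next
  case (cong f g)
  then obtain f' where f': "f' \<in> expansions S (Suc n)"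
    "\<And>s \<xi>. s > 0 \<Longrightarrow> ((\<lambda>r. f r \<xi>) has_vector_derivative f' s \<xi>) (at s)" by blast
  have "((\<lambda>r. g r \<xi>) has_vector_derivative f' s \<xi>) (at s)" if "s > 0" for s \<xi>
    by (rule has_vector_derivative_transform_within_open[OF f'(2)[OF that], of "{0<..}"])
       (use that cong in auto)
  with f' show ?case by blast
qed

lemma expansions_bound:
  assumes "f \<in> expansions S n" "compact S"
  shows "\<exists>C\<ge>0. \<exists>d. \<forall>s\<ge>1. \<forall>\<xi>. cmod (f s \<xi>) \<le> C * (1 / s ^ n) * (1 + ln s) ^ d"
  using assms(1)
proof induction
  case (monomial c k j)
  obtain B where B: "B \<ge> 0" "\<And>x. cmod (c x) \<le> B"
    using supported_smooth_bounded[OF assms(2) monomial(1)] by blast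
  have "cmod (c \<xi> * of_real (1 / s ^ k) * of_real (ln s ^ j)) \<le> B * (1 / s ^ n) * (1 + ln s) ^ j"
    if "s \<ge> 1" for s \<xi>
    unfolding norm_mult
  proof (intro mult_mono)
    show "cmod (of_real (1 / s ^ k)) \<le> 1 / s ^ n"
      using that monomial(2) by (simp add: norm_power norm_divide frac_le power_increasing)
    show "cmod (of_real (ln s ^ j)) \<le> (1 + ln s) ^ j"
      using that by (simp add: norm_power power_mono)
  qed (use B that in auto)
  with B show ?case by blast
next
  case (add f g)
  then obtain C d C' d' where C: "C \<ge> 0" "C' \<ge> 0"
    "\<And>s \<xi>. s \<ge> 1 \<Longrightarrow> cmod (f s \<xi>) \<le> C * (1 / s ^ n) * (1 + ln s) ^ d"
    "\<And>s \<xi>. s \<ge> 1 \<Longrightarrow> cmod (g s \<xi>) \<le> C' * (1 / s ^ n) * (1 + ln s) ^ d'" by blast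
  have "cmod (f s \<xi> + g s \<xi>) \<le> (C + C') * (1 / s ^ n) * (1 + ln s) ^ max d d'"
    if "s \<ge> 1" for s \<xi>
  proof -
    have "(1 + ln s) ^ d \<le> (1 + ln s) ^ max d d'" "(1 + ln s) ^ d' \<le> (1 + ln s) ^ max d d'"
      using that by (auto intro!: power_increasing)
    then have "C * (1 / s ^ n) * (1 + ln s) ^ d \<le> C * (1 / s ^ n) * (1 + ln s) ^ max d d'"
      "C' * (1 / s ^ n) * (1 + ln s) ^ d' \<le> C' * (1 / s ^ n) * (1 + ln s) ^ max d d'"
      using C that by (auto intro!: mult_left_mono divide_right_mono)
    with C(3)[OF that, of \<xi>] C(4)[OF that, of \<xi>] show ?thesis
      using norm_triangle_ineq[of "f s \<xi>" "g s \<xi>"] by (simp only: ring_distribs)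
  qed
  with C show ?case by (meson add_nonneg_nonneg)
next
  case (cong f g)
  then obtain C d where "C \<ge> 0" "\<And>s \<xi>. s \<ge> 1 \<Longrightarrow> cmod (f s \<xi>) \<le> C * (1 / s ^ n) * (1 + ln s) ^ d"
    by blast
  with cong(2) show ?case by (metis less_le_trans zero_less_one)
qed

text \<open>Polynomials in a variable \<open>l\<close> that stands for \<open>log s\<close>. The coefficient sequence is defined beyond
  the degree, and its members are required to be in the ring there too, so that sequences of
  different degrees can be combined freely.\<close>

definition log_polynomials :: "real set \<Rightarrow> (real \<Rightarrow> real \<Rightarrow> complex) set" where
  "log_polynomials S = {\<lambda>l \<xi>. \<Sum>j=0..J. c j \<xi> * of_real (l ^ j) | J c.
     \<forall>j. c j \<in> supported_smooth S}"

lemma log_polynomials_monomial: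
  assumes "c \<in> supported_smooth S"
  shows "(\<lambda>l \<xi>. c \<xi> * of_real (l ^ j)) \<in> log_polynomials S"
  unfolding log_polynomials_def mem_Collect_eq
proof (intro exI conjI)
  show "(\<lambda>l \<xi>. c \<xi> * of_real (l ^ j)) =
      (\<lambda>l \<xi>. \<Sum>i=0..j. (if i = j then c else (\<lambda>_. 0)) \<xi> * of_real (l ^ i))"
    by (simp add: fun_eq_iff if_distrib[of "\<lambda>f. f _"] if_distrib[of "\<lambda>z. z * _"] cong: if_cong)
qed (use assms supported_smooth_zero in auto)

lemma log_polynomials_add:
  assumes "p \<in> log_polynomials S" "q \<in> log_polynomials S"
  shows "(\<lambda>l \<xi>. p l \<xi> + q l \<xi>) \<in> log_polynomials S"
proof -
  obtain J c I b where p: "p = (\<lambda>l \<xi>. \<Sum>j=0..J. c j \<xi> * of_real (l ^ j))"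
    and q: "q = (\<lambda>l \<xi>. \<Sum>j=0..I. b j \<xi> * of_real (l ^ j))"
    and cb: "\<And>j. c j \<in> supported_smooth S" "\<And>j. b j \<in> supported_smooth S"
    using assms by (auto simp: log_polynomials_def)
  define h where "h j \<xi> = (if j \<le> J then c j \<xi> else 0) + (if j \<le> I then b j \<xi> else 0)" for j \<xi>
  have *: "(\<Sum>j=0..max J I. (if j \<le> N then a j else 0) * of_real (l ^ j)) =
     (\<Sum>j=0..N. a j * of_real (l ^ j))" if "N \<le> max J I" for N l and a :: "nat \<Rightarrow> complex"
    by (rule sum.mono_neutral_cong_right) (use that in auto)
  have "(\<lambda>l \<xi>. p l \<xi> + q l \<xi>) = (\<lambda>l \<xi>. \<Sum>j=0..max J I. h j \<xi> * of_real (l ^ j))"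
    unfolding p q h_def ring_distribs sum.distrib by (subst (1 2) *) auto
  moreover have "h j \<in> supported_smooth S" for j
    unfolding h_def using cb supported_smooth_zero
    by (intro supported_smooth_add) (cases "j \<le> J"; cases "j \<le> I"; simp)+
  ultimately show ?thesis unfolding log_polynomials_def by blast
qed

lemma expansions_log_polynomial:
  assumes "p \<in> log_polynomials S"
  shows "(\<lambda>s \<xi>. of_real (1 / s ^ n) * p (ln s) \<xi>) \<in> expansions S n"
proof -
  obtain J c where p: "p = (\<lambda>l \<xi>. \<Sum>j=0..J. c j \<xi> * of_real (l ^ j))"
    and c: "\<And>j. c j \<in> supported_smooth S"
    using assms by (auto simp: log_polynomials_def)
  have "(\<lambda>s \<xi>. \<Sum>j=0..J. c j \<xi> * of_real (1 / s ^ n) * of_real (ln s ^ j)) \<in> expansions S n"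
    for J
  proof (induction J)
    case 0
    show ?case using expansions.monomial[OF c[of 0], of n n 0] by simp
  next
    case (Suc J)
    show ?case using expansions.add[OF Suc expansions.monomial[OF c[of "Suc J"], of n n "Suc J"]]
      by simp
  qed
  then show ?thesis
    by (rule expansions.cong) (simp add: p sum_distrib_left mult_ac)
qed

text \<open>Level \<open>n\<close> modulo level \<open>n + 1\<close>: the leading coefficient is a polynomial in \<open>log s\<close>.\<close>

lemma expansions_split:
  assumes "f \<in> expansions S n"
  shows "\<exists>p\<in>log_polynomials S.
    (\<lambda>s \<xi>. f s \<xi> - of_real (1 / s ^ n) * p (ln s) \<xi>) \<in> expansions S (Suc n)"
  using assms
proof induction
  case (monomial c k j)
  show ?case
  proof (cases "k = n")
    case True
    have "(\<lambda>s \<xi>. c \<xi> * of_real (1 / s ^ k) * of_real (ln s ^ j)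
        - of_real (1 / s ^ n) * (c \<xi> * of_real (ln s ^ j))) \<in> expansions S (Suc n)"
      by (rule expansions.cong[OF expansions_zero]) (simp add: True mult_ac)
    with log_polynomials_monomial[OF monomial(1), of j] show ?thesis
      by (intro bexI[of _ "\<lambda>l \<xi>. c \<xi> * of_real (l ^ j)"]) auto
  next
    case False
    have "(\<lambda>s \<xi>. c \<xi> * of_real (1 / s ^ k) * of_real (ln s ^ j)
        - of_real (1 / s ^ n) * (0 * of_real (ln s ^ 0))) \<in> expansions S (Suc n)"
      using expansions.monomial[OF monomial(1), of "Suc n" k j] monomial(2) False by simp
    with log_polynomials_monomial[OF supported_smooth_zero, of 0] show ?thesis
      by (intro bexI[of _ "\<lambda>l \<xi>. 0 * of_real (l ^ 0)"]) auto
  qed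
next
  case (add f g)
  then obtain p q where pq: "p \<in> log_polynomials S" "q \<in> log_polynomials S"
    "(\<lambda>s \<xi>. f s \<xi> - of_real (1 / s ^ n) * p (ln s) \<xi>) \<in> expansions S (Suc n)"
    "(\<lambda>s \<xi>. g s \<xi> - of_real (1 / s ^ n) * q (ln s) \<xi>) \<in> expansions S (Suc n)" by blast
  have "(\<lambda>s \<xi>. f s \<xi> + g s \<xi> - of_real (1 / s ^ n) * (p (ln s) \<xi> + q (ln s) \<xi>))
      \<in> expansions S (Suc n)"
    by (rule expansions.cong[OF expansions.add[OF pq(3,4)]]) (simp add: algebra_simps)
  with log_polynomials_add[OF pq(1,2)] show ?case
    by (intro bexI[of _ "\<lambda>l \<xi>. p l \<xi> + q l \<xi>"]) auto
next
  case (cong f g)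
  then obtain p where p: "p \<in> log_polynomials S"
    "(\<lambda>s \<xi>. f s \<xi> - of_real (1 / s ^ n) * p (ln s) \<xi>) \<in> expansions S (Suc n)" by blast
  have "(\<lambda>s \<xi>. g s \<xi> - of_real (1 / s ^ n) * p (ln s) \<xi>) \<in> expansions S (Suc n)"
    by (rule expansions.cong[OF p(2)]) (simp add: cong)
  with p show ?case by blast
qed

section \<open>The transport equation in the logarithmic variable\<close>

text \<open>The derivative of \<open>U \<mapsto> - i \<beta> |U|\<^sup>2 U\<close> at the leading profile, in the frame that rotates with the
  phase. It is linear over the reals only, because of the conjugate. Its square is zero: a real
  direction along \<open>a\<close> is sent to the direction \<open>i a\<close>, which is annihilated.\<close>

definition nilpotent_part :: "real \<Rightarrow> complex \<Rightarrow> complex \<Rightarrow> complex" where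
  "nilpotent_part \<beta> a z = - \<i> * of_real \<beta> * (a * cnj a * z + a * a * cnj z)"

lemma nilpotent_part_square: "nilpotent_part \<beta> a (nilpotent_part \<beta> a z) = 0"
  by (simp add: nilpotent_part_def algebra_simps)

lemma nilpotent_part_add:
  "nilpotent_part \<beta> a (z + w) = nilpotent_part \<beta> a z + nilpotent_part \<beta> a w"
  by (simp add: nilpotent_part_def algebra_simps)

lemma nilpotent_part_scale:
  "nilpotent_part \<beta> a (of_real r * z) = of_real r * nilpotent_part \<beta> a z"
  by (simp add: nilpotent_part_def algebra_simps)

lemma supported_smooth_nilpotent_part:
  assumes "A \<in> supported_smooth S" "c \<in> supported_smooth S"
  shows "(\<lambda>\<xi>. nilpotent_part \<beta> (A \<xi>) (c \<xi>)) \<in> supported_smooth S"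
  unfolding nilpotent_part_def
  by (intro supported_smooth_cmult supported_smooth_add supported_smooth_mult
      supported_smooth_cnj assms)

text \<open>The equation \<open>P' = (k + M) P + G\<close> in the ring of polynomials in \<open>l\<close>, where \<open>M\<close> is the nilpotent part.
  Since \<open>M\<^sup>2 = 0\<close> and \<open>k \<noteq> 0\<close>, the operator \<open>k + M\<close> has the inverse \<open>k^(-1) - k^(-2) M\<close>, which involves no division by
  functions of \<open>\<xi>\<close> and so preserves smoothness and support. The top coefficient of \<open>P\<close> is therefore
  determined by that of \<open>G\<close>; subtracting it lowers the degree of the right-hand side, at the cost of
  a derivative \<open>J h l^(J-1)\<close> which is absorbed into the next coefficient.\<close>

lemma transport_solvable_sum:
  fixes g :: "nat \<Rightarrow> real \<Rightarrow> complex" and k :: real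
  assumes "A \<in> supported_smooth S" "k \<noteq> 0"
  shows "(\<forall>j. g j \<in> supported_smooth S) \<Longrightarrow>
    \<exists>P\<in>log_polynomials S. \<forall>l \<xi>. ((\<lambda>l. P l \<xi>) has_vector_derivative
      of_real k * P l \<xi> + nilpotent_part \<beta> (A \<xi>) (P l \<xi>)
        + (\<Sum>j<J. g j \<xi> * of_real (l ^ j))) (at l)"
proof (induction J arbitrary: g)
  case 0
  show ?case
    using log_polynomials_monomial[OF supported_smooth_zero, of 0]
    by (intro bexI[of _ "\<lambda>l \<xi>. 0 * of_real (l ^ 0)"]) (auto simp: nilpotent_part_def)
next
  case (Suc J)
  \<comment> \<open>The value of \<open>- (k + M)^(-1)\<close> at the top coefficient.\<close>
  define h where "h \<xi> = - of_real (1 / k) * (g J \<xi>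
    + of_real (- 1 / k) * nilpotent_part \<beta> (A \<xi>) (g J \<xi>))" for \<xi>
  have h: "h \<in> supported_smooth S"
    unfolding h_def using Suc.prems
    by (intro supported_smooth_cmult supported_smooth_add supported_smooth_nilpotent_part assms) auto
  have solve: "of_real k * h \<xi> + nilpotent_part \<beta> (A \<xi>) (h \<xi>) = - g J \<xi>" for \<xi>
  proof -
    have "nilpotent_part \<beta> (A \<xi>) (h \<xi>) = of_real (- 1 / k) * nilpotent_part \<beta> (A \<xi>) (g J \<xi>)"
      unfolding h_def of_real_minus[symmetric]
      by (simp only: nilpotent_part_scale nilpotent_part_add nilpotent_part_square) simp
    then show ?thesis using assms(2) by (simp add: h_def field_simps)
  qed
  define g' where "g' j \<xi> = g j \<xi> + of_real (if Suc j = J then - real J else 0) * h \<xi>" for j \<xi>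
  have "\<forall>j. g' j \<in> supported_smooth S"
    unfolding g'_def using Suc.prems h by (intro allI supported_smooth_add supported_smooth_cmult) auto
  from Suc.IH[OF this] obtain Q where Q: "Q \<in> log_polynomials S"
    "\<And>l \<xi>. ((\<lambda>l. Q l \<xi>) has_vector_derivative
      of_real k * Q l \<xi> + nilpotent_part \<beta> (A \<xi>) (Q l \<xi>)
        + (\<Sum>j<J. g' j \<xi> * of_real (l ^ j))) (at l)" by blast
  have sum': "(\<Sum>j<J. g' j \<xi> * of_real (l ^ j)) =
      (\<Sum>j<J. g j \<xi> * of_real (l ^ j)) - of_nat J * h \<xi> * of_real (l ^ (J - 1))" for l \<xi>
    by (cases J) (simp_all add: g'_def algebra_simps)
  define P where "P l \<xi> = h \<xi> * of_real (l ^ J) + Q l \<xi>" for l \<xi>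
  have "((\<lambda>l. P l \<xi>) has_vector_derivative
      of_real k * P l \<xi> + nilpotent_part \<beta> (A \<xi>) (P l \<xi>)
        + (\<Sum>j<Suc J. g j \<xi> * of_real (l ^ j))) (at l)" for l \<xi>
  proof -
    have "((\<lambda>l. l ^ J) has_real_derivative real J * l ^ (J - 1)) (at l)"
      using DERIV_pow[of J l] by simp
    then have deriv: "((\<lambda>l. P l \<xi>) has_vector_derivative
        h \<xi> * of_real (real J * l ^ (J - 1)) + (of_real k * Q l \<xi>
        + nilpotent_part \<beta> (A \<xi>) (Q l \<xi>) + (\<Sum>j<J. g' j \<xi> * of_real (l ^ j)))) (at l)"
      unfolding P_def
      by (intro has_vector_derivative_add has_vector_derivative_mult_right
          has_vector_derivative_of_real Q)
    have split: "nilpotent_part \<beta> (A \<xi>) (P l \<xi>) =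
        of_real (l ^ J) * (- g J \<xi> - of_real k * h \<xi>) + nilpotent_part \<beta> (A \<xi>) (Q l \<xi>)"
    proof -
      have "nilpotent_part \<beta> (A \<xi>) (h \<xi>) = - g J \<xi> - of_real k * h \<xi>"
        using solve[of \<xi>] by (simp add: eq_diff_eq add.commute)
      then show ?thesis
        unfolding P_def nilpotent_part_add mult.commute[of "h \<xi>"] nilpotent_part_scale by simp
    qed
    show ?thesis
      by (rule has_vector_derivative_eq_rhs[OF deriv], unfold split sum')
         (simp add: P_def algebra_simps)
  qed
  moreover have "P \<in> log_polynomials S"
    unfolding P_def by (intro log_polynomials_add log_polynomials_monomial h) (use Q in simp)
  ultimately show ?case by (intro bexI[of _ P]) auto
qed

lemma transport_solvable:
  fixes k :: real
  assumes "A \<in> supported_smooth S" "k \<noteq> 0" "G \<in> log_polynomials S"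
  shows "\<exists>P\<in>log_polynomials S. \<forall>l \<xi>. ((\<lambda>l. P l \<xi>) has_vector_derivative
      of_real k * P l \<xi> + nilpotent_part \<beta> (A \<xi>) (P l \<xi>) + \<i> * G l \<xi>) (at l)"
proof -
  obtain J c where G: "G = (\<lambda>l \<xi>. \<Sum>j=0..J. c j \<xi> * of_real (l ^ j))"
    and c: "\<And>j. c j \<in> supported_smooth S"
    using assms(3) by (auto simp: log_polynomials_def)
  have "\<forall>j. (\<lambda>\<xi>. \<i> * c j \<xi>) \<in> supported_smooth S"
    using c by (intro allI supported_smooth_cmult)
  from transport_solvable_sum[OF assms(1,2) this, of \<beta> "Suc J"] show ?thesis
    by (simp add: G sum_distrib_left lessThan_Suc_atMost atLeast0AtMost mult.assoc)
qed

section \<open>Expansions multiplied by the phase\<close>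

text \<open>For \<open>U = \<omega> V\<close> the phase is a common factor of every term of the equation, so that all
  computations take place on the amplitude \<open>V\<close>.\<close>

locale profile =
  fixes \<beta> :: real and A :: "real \<Rightarrow> complex" and S :: "real set"
  assumes compact: "compact S" and A: "A \<in> supported_smooth S"
begin

abbreviation \<omega> :: "real \<Rightarrow> real \<Rightarrow> complex" where
  "\<omega> \<equiv> phase \<beta> A"

text \<open>This is \<open>|A|\<^sup>2\<close>, written as a product so that it is visibly an element of the ring.\<close>

definition density :: "real \<Rightarrow> complex" where
  "density \<xi> = A \<xi> * cnj (A \<xi>)"

text \<open>The operator \<open>\<omega>^(-1) \<partial>\<^sub>\<xi> \<omega>\<close>. The derivative of the phase brings down a factor \<open>log s\<close>, which costs no power
  of \<open>s\<close>, so the operator preserves every level of the filtration. The factors with exponents \<open>0\<close> and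
  \<open>1\<close> give the multiplier the shape of a term of an expansion.\<close>

definition twisted_deriv :: "(real \<Rightarrow> real \<Rightarrow> complex) \<Rightarrow> real \<Rightarrow> real \<Rightarrow> complex" where
  "twisted_deriv V s \<xi> = vector_derivative (V s) (at \<xi>)
     + - \<i> * of_real \<beta> * of_real (1 / s ^ 0) * of_real (ln s ^ 1) * (nth_deriv 1 density \<xi> * V s \<xi>)"

definition time_deriv :: "(real \<Rightarrow> real \<Rightarrow> complex) \<Rightarrow> real \<Rightarrow> real \<Rightarrow> complex" where
  "time_deriv V s \<xi> = vector_derivative (\<lambda>r. V r \<xi>) (at s)"

lemma density: "density \<in> supported_smooth S"
  unfolding density_def by (intro supported_smooth_mult supported_smooth_cnj A)

lemma closed: "closed S"
  using compact by (rule compact_imp_closed)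

lemma phase_eq: "\<omega> s \<xi> = exp (density \<xi> * (- \<i> * of_real (\<beta> * ln s)))"
  unfolding phase_def density_def complex_norm_square[symmetric] by (simp add: mult_ac)

lemma norm_phase [simp]: "cmod (\<omega> s \<xi>) = 1"
  by (simp add: phase_def)

lemma phase_space_deriv:
  "(\<omega> s has_vector_derivative
     \<omega> s \<xi> * (- \<i> * of_real \<beta> * of_real (ln s) * nth_deriv 1 density \<xi>)) (at \<xi>)"
proof -
  have "((\<lambda>\<xi>. density \<xi> * (- \<i> * of_real (\<beta> * ln s))) has_vector_derivative
      nth_deriv 1 density \<xi> * (- \<i> * of_real (\<beta> * ln s))) (at \<xi>)"
    using density by (intro has_vector_derivative_mult_left smooth_has_deriv)
      (simp add: supported_smooth_def)
  from field_vector_diff_chain_at[OF this DERIV_exp]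
  show ?thesis unfolding phase_eq[abs_def] by (simp add: o_def mult_ac)
qed

lemma phase_time_deriv:
  assumes "s > 0"
  shows "((\<lambda>s. \<omega> s \<xi>) has_vector_derivative
     \<omega> s \<xi> * (- \<i> * of_real \<beta> * of_real (1 / s) * density \<xi>)) (at s)"
proof -
  have "((\<lambda>s. (density \<xi> * (- \<i> * of_real \<beta>)) * of_real (ln s)) has_vector_derivative
      (density \<xi> * (- \<i> * of_real \<beta>)) * of_real (1 / s)) (at s)"
    by (intro has_vector_derivative_mult_right has_vector_derivative_of_real
        DERIV_ln_divide assms)
  from field_vector_diff_chain_at[OF this DERIV_exp]
  show ?thesis unfolding phase_eq by (simp add: o_def mult_ac)
qed

lemma has_space_deriv:
  assumes "V \<in> expansions S n" "s > 0"
  shows "(V s has_vector_derivative vector_derivative (V s) (at \<xi>)) (at \<xi>)"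
  using expansions_space_deriv[OF assms(1) closed] assms(2)
  by (metis vector_derivative_at)

lemma twisted_deriv_expansions:
  assumes "V \<in> expansions S n"
  shows "twisted_deriv V \<in> expansions S n"
proof -
  obtain f' where f': "f' \<in> expansions S n"
    "\<And>s \<xi>. s > 0 \<Longrightarrow> (V s has_vector_derivative f' s \<xi>) (at \<xi>)"
    using expansions_space_deriv[OF assms closed] by blast
  have 1: "(\<lambda>s \<xi>. vector_derivative (V s) (at \<xi>)) \<in> expansions S n"
    by (rule expansions.cong[OF f'(1)]) (use f' vector_derivative_at in blast)
  have 2: "(\<lambda>s \<xi>. nth_deriv 1 density \<xi> * V s \<xi>) \<in> expansions S (0 + n)"
    by (intro expansions_mult expansions_coefficient supported_smooth_deriv closed density assms)
  have 3: "(\<lambda>s \<xi>. - \<i> * of_real \<beta> * of_real (1 / s ^ 0) * of_real (ln s ^ 1)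
      * (nth_deriv 1 density \<xi> * V s \<xi>)) \<in> expansions S (0 + (0 + n))"
    by (rule expansions_factor[OF 2])
  show ?thesis
    unfolding twisted_deriv_def[abs_def] using expansions.add[OF 1 3[unfolded add_0]] .
qed

lemma twisted_deriv_power_expansions:
  "V \<in> expansions S n \<Longrightarrow> (twisted_deriv ^^ m) V \<in> expansions S n"
  by (induction m) (auto intro: twisted_deriv_expansions)

lemma twisted_deriv_add:
  assumes "V \<in> expansions S n" "V' \<in> expansions S m" "s > 0"
  shows "twisted_deriv (\<lambda>s \<xi>. V s \<xi> + V' s \<xi>) s = (\<lambda>\<xi>. twisted_deriv V s \<xi> + twisted_deriv V' s \<xi>)"
proof
  fix \<xi>
  have "vector_derivative (\<lambda>\<xi>. V s \<xi> + V' s \<xi>) (at \<xi>) =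
      vector_derivative (V s) (at \<xi>) + vector_derivative (V' s) (at \<xi>)"
    by (intro vector_derivative_at has_vector_derivative_add has_space_deriv[OF assms(1,3)]
        has_space_deriv[OF assms(2,3)])
  then show "twisted_deriv (\<lambda>s \<xi>. V s \<xi> + V' s \<xi>) s \<xi> = twisted_deriv V s \<xi> + twisted_deriv V' s \<xi>"
    by (simp add: twisted_deriv_def algebra_simps)
qed

lemma phase_mult_deriv:
  assumes "V \<in> expansions S n" "s > 0"
  shows "((\<lambda>\<xi>. \<omega> s \<xi> * V s \<xi>) has_vector_derivative \<omega> s \<xi> * twisted_deriv V s \<xi>) (at \<xi>)"
  using has_vector_derivative_mult[OF phase_space_deriv[of s \<xi>] has_space_deriv[OF assms, of \<xi>]]
  by (simp add: twisted_deriv_def algebra_simps)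

lemma nth_deriv_phase_mult:
  assumes "V \<in> expansions S n" "s > 0"
  shows "nth_deriv m (\<lambda>\<xi>. \<omega> s \<xi> * V s \<xi>) = (\<lambda>\<xi>. \<omega> s \<xi> * (twisted_deriv ^^ m) V s \<xi>)"
  using nth_deriv_of_sequence[of "\<lambda>m \<xi>. \<omega> s \<xi> * (twisted_deriv ^^ m) V s \<xi>" m]
    phase_mult_deriv[OF twisted_deriv_power_expansions[OF assms(1)] assms(2)] by simp

lemma smooth_phase_mult:
  assumes "V \<in> expansions S n" "s > 0"
  shows "smooth (\<lambda>\<xi>. \<omega> s \<xi> * V s \<xi>)"
proof (rule smooth_coinduct[where X = "\<lambda>g. \<exists>V\<in>expansions S n. g = (\<lambda>\<xi>. \<omega> s \<xi> * V s \<xi>)"])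
  fix g assume "\<exists>V\<in>expansions S n. g = (\<lambda>\<xi>. \<omega> s \<xi> * V s \<xi>)"
  then obtain V where V: "V \<in> expansions S n" "g = (\<lambda>\<xi>. \<omega> s \<xi> * V s \<xi>)" by blast
  show "\<exists>g'. (\<exists>V\<in>expansions S n. g' = (\<lambda>\<xi>. \<omega> s \<xi> * V s \<xi>)) \<and>
      (\<forall>x. (g has_vector_derivative g' x) (at x))"
    by (rule exI[of _ "\<lambda>\<xi>. \<omega> s \<xi> * twisted_deriv V s \<xi>"])
       (use phase_mult_deriv[OF V(1) assms(2)] twisted_deriv_expansions[OF V(1)] V(2) in auto)
qed (use assms in blast)

lemma has_time_deriv:
  assumes "V \<in> expansions S n" "s > 0"
  shows "((\<lambda>r. V r \<xi>) has_vector_derivative time_deriv V s \<xi>) (at s)"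
  unfolding time_deriv_def
  using expansions_time_deriv[OF assms(1)] assms(2) by (metis vector_derivative_at)

text \<open>The residual of \<open>\<omega> V\<close> with the phase removed. The derivative of the phase in \<open>s\<close> contributes
  \<open>\<beta> s^(-1) |A|\<^sup>2 V\<close>, which cancels the cubic term at leading order.\<close>

definition reduced_residual :: "(real \<Rightarrow> real \<Rightarrow> complex) \<Rightarrow> real \<Rightarrow> real \<Rightarrow> complex" where
  "reduced_residual V s \<xi> = \<i> * time_deriv V s \<xi>
     + of_real (\<beta> / s) * (density \<xi> * V s \<xi> - V s \<xi> * V s \<xi> * cnj (V s \<xi>))
     + of_real (1 / s\<^sup>2) * twisted_deriv (twisted_deriv V) s \<xi>"

lemma residual0_phase_mult:
  assumes "V \<in> expansions S n" "s \<ge> 1"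
  shows "residual0 \<beta> (\<lambda>s \<xi>. \<omega> s \<xi> * V s \<xi>) s \<xi> = \<omega> s \<xi> * reduced_residual V s \<xi>"
proof -
  have s: "s > 0" using assms by simp
  have "((\<lambda>r. \<omega> r \<xi> * V r \<xi>) has_vector_derivative
     \<omega> s \<xi> * time_deriv V s \<xi> + \<omega> s \<xi> * (- \<i> * of_real \<beta> * of_real (1 / s) * density \<xi>) * V s \<xi>)
     (at s within {1..})"
    by (rule has_vector_derivative_at_within[OF has_vector_derivative_mult[OF
          phase_time_deriv[OF s] has_time_deriv[OF assms(1) s]]])
  moreover have "at s within {1..} \<noteq> bot"
  proof -
    have "at_right s \<le> at s within {1..}"
      using assms(2) by (intro at_le) auto
    then show ?thesis
      using trivial_limit_at_right_real[of s] by (auto simp: bot_unique)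
  qed
  ultimately have 1: "vector_derivative (\<lambda>r. \<omega> r \<xi> * V r \<xi>) (at s within {1..}) =
     \<omega> s \<xi> * time_deriv V s \<xi> + \<omega> s \<xi> * (- \<i> * of_real \<beta> * of_real (1 / s) * density \<xi>) * V s \<xi>"
    by (intro vector_derivative_within)
  have 2: "nth_deriv 2 (\<lambda>\<xi>. \<omega> s \<xi> * V s \<xi>) \<xi> = \<omega> s \<xi> * twisted_deriv (twisted_deriv V) s \<xi>"
    using nth_deriv_phase_mult[OF assms(1) s, of 2] by (simp add: numeral_2_eq_2)
  have 3: "of_real (\<beta> / s * (cmod (\<omega> s \<xi> * V s \<xi>))\<^sup>2) =
      of_real (\<beta> / s) * (V s \<xi> * cnj (V s \<xi>))"
    unfolding complex_norm_square[symmetric] by (simp add: norm_mult)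
  show ?thesis
    unfolding residual0_def 1 2 3 reduced_residual_def by (simp add: algebra_simps)
qed

end

section \<open>Improving an approximate solution by one order\<close>

context profile
begin

text \<open>For \<open>V = A\<close> the terms of order \<open>s^(-1)\<close> cancel, and only the dispersive term remains.\<close>

lemma reduced_residual_leading: "reduced_residual (\<lambda>s. A) \<in> expansions S 2"
proof -
  have "(\<lambda>s \<xi>. 1 * of_real (1 / s ^ 2) * of_real (ln s ^ 0)
      * twisted_deriv (twisted_deriv (\<lambda>s. A)) s \<xi>) \<in> expansions S (2 + 0)"
    by (intro expansions_factor twisted_deriv_expansions expansions_coefficient A)
  then have *: "(\<lambda>s \<xi>. of_real (1 / s\<^sup>2) * twisted_deriv (twisted_deriv (\<lambda>s. A)) s \<xi>)
      \<in> expansions S 2"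
    by simp
  show ?thesis
    by (rule expansions.cong[OF *])
       (simp add: reduced_residual_def time_deriv_def density_def)
qed

lemma twisted_second_deriv_add:
  assumes "V \<in> expansions S n" "V' \<in> expansions S m" "s > 0"
  shows "twisted_deriv (twisted_deriv (\<lambda>s \<xi>. V s \<xi> + V' s \<xi>)) s \<xi> =
    twisted_deriv (twisted_deriv V) s \<xi> + twisted_deriv (twisted_deriv V') s \<xi>"
proof -
  have "twisted_deriv (twisted_deriv (\<lambda>s \<xi>. V s \<xi> + V' s \<xi>)) s \<xi> =
      twisted_deriv (\<lambda>s \<xi>. twisted_deriv V s \<xi> + twisted_deriv V' s \<xi>) s \<xi>"
    by (simp add: twisted_deriv_def[of "twisted_deriv (\<lambda>s \<xi>. V s \<xi> + V' s \<xi>)"]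
        twisted_deriv_def[of "\<lambda>s \<xi>. twisted_deriv V s \<xi> + twisted_deriv V' s \<xi>"]
        twisted_deriv_add[OF assms])
  then show ?thesis
    by (simp add: twisted_deriv_add[OF twisted_deriv_expansions[OF assms(1)]
          twisted_deriv_expansions[OF assms(2)] assms(3)])
qed

lemma time_deriv_monomial:
  assumes "\<And>l. ((\<lambda>l. P l \<xi>) has_vector_derivative P' l \<xi>) (at l)" "s > 0"
  shows "time_deriv (\<lambda>s \<xi>. of_real (1 / s ^ n) * P (ln s) \<xi>) s \<xi> =
    of_real (1 / s ^ Suc n) * (P' (ln s) \<xi> - of_nat n * P (ln s) \<xi>)"
proof -
  have 1: "((\<lambda>s. P (ln s) \<xi>) has_vector_derivative (1 / s) *\<^sub>R P' (ln s) \<xi>) (at s)"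
  proof -
    have "(ln has_vector_derivative 1 / s) (at s)"
      by (rule has_real_derivative_iff_has_vector_derivative[THEN iffD1, OF DERIV_ln_divide[OF assms(2)]])
    from vector_diff_chain_at[OF this assms(1)] show ?thesis by (simp add: o_def)
  qed
  note 2 = has_deriv_inverse_power[OF assms(2), of n]
  show ?thesis
    unfolding time_deriv_def
    by (rule vector_derivative_at,
        rule has_vector_derivative_eq_rhs[OF has_vector_derivative_mult[OF
          has_vector_derivative_of_real[OF 2] 1]])
       (simp add: scaleR_conv_of_real algebra_simps)
qed

text \<open>One step of the construction. Let \<open>s^(-n-1) G(log s)\<close> be the leading part of the residual of \<open>V\<close>, and add
  \<open>\<delta> = s^(-n) P(log s)\<close> to \<open>V\<close>. At order \<open>s^(-n-1)\<close> the residual changes by the time derivative of \<open>\<delta>\<close> and by the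
  linearisation of the cubic term at \<open>A\<close>. Cancelling \<open>G\<close> is the transport equation with \<open>k = n\<close>, and
  \<open>n \<ge> 1\<close> makes it solvable. Everything else is one order smaller: replacing \<open>A\<close> by \<open>V\<close> in the linearisation
  gains a power because \<open>V - A\<close> has level \<open>1\<close>, terms of degree two or more in \<open>\<delta>\<close> have level \<open>2 n \<ge> n + 1\<close>
  before the factor \<open>s^(-1)\<close>, and the dispersive term carries \<open>s^(-2)\<close>.\<close>

lemma improve_approximation:
  assumes "n \<ge> 1" and V: "V \<in> expansions S 0"
    and VA: "(\<lambda>s \<xi>. V s \<xi> - A \<xi>) \<in> expansions S 1"
    and res: "reduced_residual V \<in> expansions S (Suc n)"
  shows "\<exists>P\<in>log_polynomials S.
    reduced_residual (\<lambda>s \<xi>. V s \<xi> + of_real (1 / s ^ n) * P (ln s) \<xi>) \<in> expansions S (Suc (Suc n))"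
proof -
  obtain G where G: "G \<in> log_polynomials S" and
    rest: "(\<lambda>s \<xi>. reduced_residual V s \<xi> - of_real (1 / s ^ Suc n) * G (ln s) \<xi>)
      \<in> expansions S (Suc (Suc n))"
    using expansions_split[OF res] by blast
  obtain P where P: "P \<in> log_polynomials S" and
    transport: "\<And>l \<xi>. ((\<lambda>l. P l \<xi>) has_vector_derivative
      of_real (real n) * P l \<xi> + nilpotent_part \<beta> (A \<xi>) (P l \<xi>) + \<i> * G l \<xi>) (at l)"
    using transport_solvable[OF A, of "real n" G \<beta>] G assms(1) by auto
  define \<delta> where "\<delta> = (\<lambda>s \<xi>. of_real (1 / s ^ n) * P (ln s) \<xi>)"
  have \<delta>: "\<delta> \<in> expansions S n"
    unfolding \<delta>_def by (rule expansions_log_polynomial[OF P])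
  have time: "\<i> * time_deriv \<delta> s \<xi> = of_real (\<beta> / s) * (density \<xi> * \<delta> s \<xi> + A \<xi> * A \<xi> * cnj (\<delta> s \<xi>))
      - of_real (1 / s ^ Suc n) * G (ln s) \<xi>" if "s > 0" for s \<xi>
  proof -
    have eq: "time_deriv \<delta> s \<xi> = of_real (1 / s ^ Suc n)
        * (nilpotent_part \<beta> (A \<xi>) (P (ln s) \<xi>) + \<i> * G (ln s) \<xi>)"
      unfolding \<delta>_def
      by (rule trans[OF time_deriv_monomial[where P' = "\<lambda>l \<xi>. of_real (real n) * P l \<xi>
            + nilpotent_part \<beta> (A \<xi>) (P l \<xi>) + \<i> * G l \<xi>"]], rule transport, rule that) simp
    show ?thesis
      unfolding eq by (simp add: \<delta>_def nilpotent_part_def density_def algebra_simps)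
  qed
  define E where "E = (\<lambda>s \<xi>. V s \<xi> - A \<xi>)"
  have E: "E \<in> expansions S 1" using VA by (simp add: E_def)
  have A': "(\<lambda>s. A) \<in> expansions S 0" by (rule expansions_coefficient[OF A])
  \<comment> \<open>What the cubic term contributes beyond its linearisation at \<open>A\<close>, expanded with \<open>V = A + E\<close>.\<close>
  define T where "T = (\<lambda>s \<xi>. - (2 * ((A \<xi> * cnj (E s \<xi>) + cnj (A \<xi>) * E s \<xi> + E s \<xi> * cnj (E s \<xi>)) * \<delta> s \<xi>))
      - (2 * (A \<xi> * E s \<xi>) + E s \<xi> * E s \<xi>) * cnj (\<delta> s \<xi>)
      - 2 * (V s \<xi> * (\<delta> s \<xi> * cnj (\<delta> s \<xi>))) - cnj (V s \<xi>) * (\<delta> s \<xi> * \<delta> s \<xi>)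
      - \<delta> s \<xi> * (\<delta> s \<xi> * cnj (\<delta> s \<xi>)))"
  have T: "T \<in> expansions S (Suc n)"
  proof -
    have linear: "(\<lambda>s \<xi>. f s \<xi> * \<delta> s \<xi>) \<in> expansions S (Suc n)"
      "(\<lambda>s \<xi>. f s \<xi> * cnj (\<delta> s \<xi>)) \<in> expansions S (Suc n)" if "f \<in> expansions S 1" for f
      using expansions_mult[OF that \<delta>] expansions_mult[OF that expansions_cnj[OF \<delta>]] by simp_all
    have quadratic: "(\<lambda>s \<xi>. f s \<xi> * (\<delta> s \<xi> * g s \<xi>)) \<in> expansions S (Suc n)"
      if "f \<in> expansions S 0" "g \<in> expansions S n" for f g
      using expansions_mono[OF expansions_mult[OF that(1) expansions_mult[OF \<delta> that(2)]]] assms(1)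
      by simp
    have ring1: "(\<lambda>s \<xi>. f s \<xi> * g s \<xi>) \<in> expansions S 1"
      if "f \<in> expansions S 0" "g \<in> expansions S 1" for f g
      using expansions_mult[OF that] by simp
    have E0: "E \<in> expansions S 0" and \<delta>0: "\<delta> \<in> expansions S 0"
      using E \<delta> by (auto intro: expansions_mono)
    note cnj' = expansions_cnj[OF E] expansions_cnj[OF A'] expansions_cnj[OF V] expansions_cnj[OF \<delta>]
    have s1: "(\<lambda>s \<xi>. A \<xi> * cnj (E s \<xi>) + cnj (A \<xi>) * E s \<xi> + E s \<xi> * cnj (E s \<xi>)) \<in> expansions S 1"
      by (intro expansions.add ring1[OF A' cnj'(1)] ring1[OF cnj'(2) E] ring1[OF E0 cnj'(1)])
    have s2: "(\<lambda>s \<xi>. 2 * (A \<xi> * E s \<xi>) + E s \<xi> * E s \<xi>) \<in> expansions S 1"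
      by (intro expansions.add expansions_cmult ring1[OF A' E] ring1[OF E0 E])
    have "(\<lambda>s \<xi>. - 2 * ((A \<xi> * cnj (E s \<xi>) + cnj (A \<xi>) * E s \<xi> + E s \<xi> * cnj (E s \<xi>)) * \<delta> s \<xi>)
      - (2 * (A \<xi> * E s \<xi>) + E s \<xi> * E s \<xi>) * cnj (\<delta> s \<xi>)
      - 2 * (V s \<xi> * (\<delta> s \<xi> * cnj (\<delta> s \<xi>))) - cnj (V s \<xi>) * (\<delta> s \<xi> * \<delta> s \<xi>)
      - \<delta> s \<xi> * (\<delta> s \<xi> * cnj (\<delta> s \<xi>))) \<in> expansions S (Suc n)"
      by (intro expansions_diff expansions_cmult linear(1)[OF s1] linear(2)[OF s2]
          quadratic[OF V cnj'(4)] quadratic[OF cnj'(3) \<delta>] quadratic[OF \<delta>0 cnj'(4)])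
    then show ?thesis by (simp add: T_def)
  qed
  have "(\<lambda>s \<xi>. (reduced_residual V s \<xi> - of_real (1 / s ^ Suc n) * G (ln s) \<xi>)
      + of_real \<beta> * of_real (1 / s ^ 1) * of_real (ln s ^ 0) * T s \<xi>
      + 1 * of_real (1 / s ^ 2) * of_real (ln s ^ 0) * twisted_deriv (twisted_deriv \<delta>) s \<xi>)
      \<in> expansions S (Suc (Suc n))"
    using expansions_factor[OF T, of \<beta> 1 0]
      expansions_factor[OF twisted_deriv_expansions[OF twisted_deriv_expansions[OF \<delta>]], of 1 2 0]
    by (intro expansions.add rest) (simp_all only: plus_1_eq_Suc add_2_eq_Suc)
  then have "reduced_residual (\<lambda>s \<xi>. V s \<xi> + \<delta> s \<xi>) \<in> expansions S (Suc (Suc n))"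
  proof (rule expansions.cong)
    fix s :: real and \<xi> assume s: "s > 0"
    have "time_deriv (\<lambda>s \<xi>. V s \<xi> + \<delta> s \<xi>) s \<xi> = time_deriv V s \<xi> + time_deriv \<delta> s \<xi>"
      unfolding time_deriv_def[of "\<lambda>s \<xi>. V s \<xi> + \<delta> s \<xi>"]
      by (intro vector_derivative_at has_vector_derivative_add has_time_deriv[OF V s]
          has_time_deriv[OF \<delta> s])
    moreover have cubic: "density \<xi> * (V s \<xi> + \<delta> s \<xi>) - (V s \<xi> + \<delta> s \<xi>) * (V s \<xi> + \<delta> s \<xi>) * cnj (V s \<xi> + \<delta> s \<xi>)
        + (density \<xi> * \<delta> s \<xi> + A \<xi> * A \<xi> * cnj (\<delta> s \<xi>))
      = density \<xi> * V s \<xi> - V s \<xi> * V s \<xi> * cnj (V s \<xi>) + T s \<xi>"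
      by (simp add: T_def E_def density_def algebra_simps)
    moreover have "\<i> * (v + d) + b * X + c * w = \<i> * v - g + b * Z + c * w"
      if "X + Y = Z" "\<i> * d = b * Y - g" for v d b X c w g Y Z :: complex
      using that(2) by (simp add: that(1)[symmetric] distrib_left)
    ultimately have "reduced_residual (\<lambda>s \<xi>. V s \<xi> + \<delta> s \<xi>) s \<xi> = \<i> * time_deriv V s \<xi>
        - of_real (1 / s ^ Suc n) * G (ln s) \<xi>
        + of_real (\<beta> / s) * (density \<xi> * V s \<xi> - V s \<xi> * V s \<xi> * cnj (V s \<xi>) + T s \<xi>)
        + of_real (1 / s\<^sup>2) * (twisted_deriv (twisted_deriv V) s \<xi> + twisted_deriv (twisted_deriv \<delta>) s \<xi>)"
      unfolding reduced_residual_def twisted_second_deriv_add[OF V \<delta> s]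
      using time[OF s, of \<xi>] by presburger
    then show "reduced_residual (\<lambda>s \<xi>. V s \<xi> + \<delta> s \<xi>) s \<xi> =
        (reduced_residual V s \<xi> - of_real (1 / s ^ Suc n) * G (ln s) \<xi>)
      + of_real \<beta> * of_real (1 / s ^ 1) * of_real (ln s ^ 0) * T s \<xi>
      + 1 * of_real (1 / s ^ 2) * of_real (ln s ^ 0) * twisted_deriv (twisted_deriv \<delta>) s \<xi>"
      unfolding reduced_residual_def by (simp add: algebra_simps)
  qed
  with P show ?thesis unfolding \<delta>_def by blast
qed

text \<open>The levels of the residual are improved one at a time, and each improvement extends the previous
  amplitude by one term. One sequence of coefficients therefore serves every order \<open>n\<close>.\<close>

lemma approximate_solutions:
  "\<exists>P. \<forall>n. P n \<in> log_polynomials S \<and>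
    (let V = (\<lambda>s \<xi>. A \<xi> + (\<Sum>k=1..n. of_real (1 / s ^ k) * P k (ln s) \<xi>))
     in V \<in> expansions S 0 \<and> reduced_residual V \<in> expansions S (Suc (Suc n)))"
proof -
  let ?good = "\<lambda>n V. V \<in> expansions S 0 \<and> (\<lambda>s \<xi>. V s \<xi> - A \<xi>) \<in> expansions S 1
    \<and> reduced_residual V \<in> expansions S (Suc (Suc n))"
  let ?next = "\<lambda>n V V'. \<exists>P\<in>log_polynomials S.
    V' = (\<lambda>s \<xi>. V s \<xi> + of_real (1 / s ^ Suc n) * P (ln s) \<xi>)"
  obtain V where V0: "V 0 = (\<lambda>s. A)" and V: "\<And>n. ?good n (V n)" "\<And>n. ?next n (V n) (V (Suc n))"
  proof -
    \<comment> \<open>The choice principle does not fix the starting point, hence the clause for \<open>n = 0\<close>.\<close>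
    have "\<exists>V. \<forall>n. (?good n (V n) \<and> (n = 0 \<longrightarrow> V n = (\<lambda>s. A))) \<and> ?next n (V n) (V (Suc n))"
    proof (rule dependent_nat_choice)
      show "\<exists>V. ?good 0 V \<and> (0 = (0::nat) \<longrightarrow> V = (\<lambda>s. A))"
        using expansions_coefficient[OF A] reduced_residual_leading expansions_zero[of S 1]
        by (intro exI[of _ "\<lambda>s. A"]) (simp add: numeral_2_eq_2)
    next
      fix V n assume V: "?good n V \<and> (n = 0 \<longrightarrow> V = (\<lambda>s. A))"
      then have good: "V \<in> expansions S 0" "(\<lambda>s \<xi>. V s \<xi> - A \<xi>) \<in> expansions S 1"
        "reduced_residual V \<in> expansions S (Suc (Suc n))" by blast+
      have "1 \<le> Suc n" by simp
      from improve_approximation[OF this good] obtain P where P: "P \<in> log_polynomials S"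
        "reduced_residual (\<lambda>s \<xi>. V s \<xi> + of_real (1 / s ^ Suc n) * P (ln s) \<xi>)
          \<in> expansions S (Suc (Suc (Suc n)))"
        by (rule bexE)
      have small: "(\<lambda>s \<xi>. of_real (1 / s ^ Suc n) * P (ln s) \<xi>) \<in> expansions S 1"
        by (rule expansions_mono[OF expansions_log_polynomial[OF P(1)]]) simp
      have "(\<lambda>s \<xi>. V s \<xi> + of_real (1 / s ^ Suc n) * P (ln s) \<xi>) \<in> expansions S 0"
        by (intro expansions.add good expansions_mono[OF small]) simp
      moreover have "(\<lambda>s \<xi>. V s \<xi> + of_real (1 / s ^ Suc n) * P (ln s) \<xi> - A \<xi>) \<in> expansions S 1"
        using expansions.add[OF good(2) small] by (simp add: diff_add_eq)
      ultimately show "\<exists>V'. (?good (Suc n) V' \<and> (Suc n = 0 \<longrightarrow> V' = (\<lambda>s. A))) \<and> ?next n V V'"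
        using P
        by (intro exI[of _ "\<lambda>s \<xi>. V s \<xi> + of_real (1 / s ^ Suc n) * P (ln s) \<xi>"] conjI bexI[of _ P])
           simp_all
    qed
    then obtain V where "\<forall>n. (?good n (V n) \<and> (n = 0 \<longrightarrow> V n = (\<lambda>s. A))) \<and> ?next n (V n) (V (Suc n))"
      by (rule exE)
    then show ?thesis by (intro that[of V]) auto
  qed
  have "\<exists>P. \<forall>n. P n \<in> log_polynomials S \<and>
      V (Suc n) = (\<lambda>s \<xi>. V n s \<xi> + of_real (1 / s ^ Suc n) * P n (ln s) \<xi>)"
    by (rule choice) (use V(2) in \<open>simp add: Bex_def\<close>)
  then obtain P where "\<forall>n. P n \<in> log_polynomials S \<and>
      V (Suc n) = (\<lambda>s \<xi>. V n s \<xi> + of_real (1 / s ^ Suc n) * P n (ln s) \<xi>)"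
    by (rule exE)
  then have P: "P n \<in> log_polynomials S"
    "V (Suc n) = (\<lambda>s \<xi>. V n s \<xi> + of_real (1 / s ^ Suc n) * P n (ln s) \<xi>)" for n
    by (rule allE[of _ n], simp only:)+
  have "V n = (\<lambda>s \<xi>. A \<xi> + (\<Sum>k=1..n. of_real (1 / s ^ k) * P (k - 1) (ln s) \<xi>))" for n
    by (induction n) (simp_all add: V0 P(2) add.assoc)
  with V(1) P(1) show ?thesis
    by (intro exI[of _ "\<lambda>k. P (k - 1)"]) (simp add: Let_def)
qed

end

section \<open>Bounds for the residuals\<close>

lemma nth_deriv_sum:
  assumes "smooth f" "smooth g"
  shows "nth_deriv m (\<lambda>x. f x + g x) = (\<lambda>x. nth_deriv m f x + nth_deriv m g x)"
  using nth_deriv_of_sequence[of "\<lambda>m x. nth_deriv m f x + nth_deriv m g x" m]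
    has_vector_derivative_add[OF smooth_has_nth_deriv[OF assms(1)] smooth_has_nth_deriv[OF assms(2)]]
  by simp

lemma has_deriv_rescaled:
  assumes "smooth W"
  shows "((\<lambda>x. complex_of_real (s ^ a * nth_deriv a W (s * (x + \<gamma>)))) has_vector_derivative
    of_real (s ^ Suc a * nth_deriv (Suc a) W (s * (x + \<gamma>)))) (at x)"
proof -
  have "(nth_deriv a W has_real_derivative nth_deriv (Suc a) W (s * (x + \<gamma>))) (at (s * (x + \<gamma>)))"
    by (rule has_real_derivative_iff_has_vector_derivative[THEN iffD2, OF smooth_has_nth_deriv[OF assms]])
  moreover have "((\<lambda>x. s * (x + \<gamma>)) has_real_derivative s) (at x)"
    by (auto intro!: derivative_eq_intros)
  ultimately have "((\<lambda>x. nth_deriv a W (s * (x + \<gamma>))) has_real_derivative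
      nth_deriv (Suc a) W (s * (x + \<gamma>)) * s) (at x)"
    by (rule DERIV_chain2)
  from has_vector_derivative_of_real[OF DERIV_cmult[OF this, of "s ^ a"]]
  show ?thesis by (simp add: mult_ac)
qed

lemma smooth_rescaled:
  assumes "smooth W"
  shows "smooth (\<lambda>x. complex_of_real (W (s * (x + \<gamma>))))"
proof -
  have seq: "nth_deriv a (\<lambda>x. complex_of_real (W (s * (x + \<gamma>)))) =
      (\<lambda>x. of_real (s ^ a * nth_deriv a W (s * (x + \<gamma>))))" for a
    using nth_deriv_of_sequence[where
        F = "\<lambda>a x. complex_of_real (s ^ a * nth_deriv a W (s * (x + \<gamma>)))" and m = a,
        OF has_deriv_rescaled[OF assms]] by simp
  show ?thesis
    unfolding smooth_def seq using has_deriv_rescaled[OF assms] differentiableI_vector by blast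
qed

text \<open>On a compact support the supremum controls the \<open>L\<^sup>2\<close> norm. Continuity and compactness give the square
  integrability without which a bound on \<open>L2_norm\<close> is empty.\<close>

lemma L2_bounded_of_sup_bound:
  assumes cont: "continuous_on UNIV f" and S: "compact S"
    and outside: "\<And>x. x \<notin> S \<Longrightarrow> f x = 0" and B: "\<And>x. cmod (f x) \<le> B"
  shows "L2_bounded f (B * sqrt (measure lborel S))"
proof -
  have [measurable]: "f \<in> borel_measurable lborel"
    using borel_measurable_continuous_onI[OF cont] by simp
  have [measurable]: "S \<in> sets borel"
    using S by (simp add: borel_compact)
  have "B \<ge> 0" using B[of 0] norm_ge_zero order_trans by blast
  have fin: "emeasure lborel S < \<infinity>"
    using S emeasure_compact_finite by blast
  have majorant: "integrable lborel (\<lambda>x. B\<^sup>2 * indicator S x :: real)"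
    using fin by (intro integrable_mult_right integrable_real_indicator) auto
  have le: "(cmod (f x))\<^sup>2 \<le> B\<^sup>2 * indicator S x" for x
    using B[of x] outside[of x] by (cases "x \<in> S") (auto intro: power_mono)
  have int: "integrable lborel (\<lambda>x. (cmod (f x))\<^sup>2)"
    by (rule Bochner_Integration.integrable_bound[OF majorant]) (use le in \<open>auto simp: abs_of_nonneg\<close>)
  have "(LINT x|lborel. (cmod (f x))\<^sup>2) \<le> (LINT x|lborel. B\<^sup>2 * indicator S x)"
    by (rule integral_mono[OF int majorant le])
  also have "\<dots> = B\<^sup>2 * measure lborel S"
    by simp
  finally have "L2_norm f \<le> sqrt (B\<^sup>2 * measure lborel S)"
    by (simp add: L2_norm_def)
  also have "\<dots> = B * sqrt (measure lborel S)"
    using \<open>B \<ge> 0\<close> by (simp add: real_sqrt_mult)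
  finally show ?thesis
    using int by (simp add: L2_bounded_def square_integrable_def)
qed

lemma expansions_family_bound:
  fixes h :: "nat \<Rightarrow> real \<Rightarrow> real \<Rightarrow> complex"
  assumes "\<And>a. h a \<in> expansions S n" "compact S"
  shows "\<exists>C\<ge>0. \<exists>d. \<forall>a\<le>m. \<forall>s\<ge>1. \<forall>\<xi>. cmod (h a s \<xi>) \<le> C * (1 / s ^ n) * (1 + ln s) ^ d"
proof -
  have "\<forall>a. \<exists>C d. C \<ge> 0 \<and> (\<forall>s\<ge>1. \<forall>\<xi>. cmod (h a s \<xi>) \<le> C * (1 / s ^ n) * (1 + ln s) ^ d)"
    using expansions_bound[OF assms] by blast
  then obtain C d where C: "\<And>a. C a \<ge> 0"
    "\<And>a s \<xi>. s \<ge> 1 \<Longrightarrow> cmod (h a s \<xi>) \<le> C a * (1 / s ^ n) * (1 + ln s) ^ d a"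
    by metis
  have sum: "sum C {..m} \<ge> 0" using C(1) by (simp add: sum_nonneg)
  have "cmod (h a s \<xi>) \<le> sum C {..m} * (1 / s ^ n) * (1 + ln s) ^ sum d {..m}"
    if "a \<le> m" "s \<ge> 1" for a s \<xi>
  proof (rule order_trans[OF C(2)[OF that(2)]], intro mult_mono)
    show "C a \<le> sum C {..m}" using that C by (intro member_le_sum) auto
    show "(1 + ln s) ^ d a \<le> (1 + ln s) ^ sum d {..m}"
      by (rule power_increasing) (use that member_le_sum[of a "{..m}" d] in auto)
  qed (use that C(1) sum in auto)
  then show ?thesis using sum by blast
qed

context profile
begin

text \<open>The Leibniz rule with the factors \<open>s^a\<close> of the chain rule kept next to the derivatives of \<open>W\<close>, whose decay
  compensates them. The amplitudes \<open>h\<close> are chosen before \<open>W\<close>: this makes the exponent of the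
  logarithm uniform in the potential, and confines the dependence of the constant on \<open>W\<close> to bounds
  for its derivatives.\<close>

lemma nth_deriv_potential_mult:
  assumes "Q \<in> expansions S n"
  shows "\<exists>h. (\<forall>a. h a \<in> expansions S n) \<and> (\<forall>W \<gamma> s. smooth W \<longrightarrow> s > 0 \<longrightarrow>
    nth_deriv m (\<lambda>\<xi>. of_real (W (s * (\<xi> + \<gamma>))) * (\<omega> s \<xi> * Q s \<xi>)) =
    (\<lambda>\<xi>. \<Sum>a\<le>m. of_real (s ^ a * nth_deriv a W (s * (\<xi> + \<gamma>))) * (\<omega> s \<xi> * h a s \<xi>)))"
proof (induction m)
  case 0
  show ?case using assms by (intro exI[of _ "\<lambda>_. Q"]) simp
next
  case (Suc m)
  then obtain h where h: "\<And>a. h a \<in> expansions S n" and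
    deriv: "\<And>W \<gamma> s. smooth W \<Longrightarrow> s > 0 \<Longrightarrow>
      nth_deriv m (\<lambda>\<xi>. of_real (W (s * (\<xi> + \<gamma>))) * (\<omega> s \<xi> * Q s \<xi>)) =
      (\<lambda>\<xi>. \<Sum>a\<le>m. of_real (s ^ a * nth_deriv a W (s * (\<xi> + \<gamma>))) * (\<omega> s \<xi> * h a s \<xi>))"
    by blast
  define h' where "h' a = (\<lambda>s \<xi>. (if a \<le> m then twisted_deriv (h a) s \<xi> else 0)
    + (if a = 0 then 0 else h (a - 1) s \<xi>))" for a
  have "h' a \<in> expansions S n" for a
    unfolding h'_def using h twisted_deriv_expansions[OF h] expansions_zero
    by (intro expansions.add) (cases "a \<le> m"; cases "a = 0"; simp)+
  moreover have "nth_deriv (Suc m) (\<lambda>\<xi>. of_real (W (s * (\<xi> + \<gamma>))) * (\<omega> s \<xi> * Q s \<xi>)) =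
      (\<lambda>\<xi>. \<Sum>a\<le>Suc m. of_real (s ^ a * nth_deriv a W (s * (\<xi> + \<gamma>))) * (\<omega> s \<xi> * h' a s \<xi>))"
    if W: "smooth W" and s: "s > 0" for W \<gamma> s
  proof
    fix \<xi>
    let ?W = "\<lambda>a \<xi>. complex_of_real (s ^ a * nth_deriv a W (s * (\<xi> + \<gamma>)))"
    have "((\<lambda>\<xi>. \<Sum>a\<le>m. ?W a \<xi> * (\<omega> s \<xi> * h a s \<xi>)) has_vector_derivative
        (\<Sum>a\<le>m. ?W a \<xi> * (\<omega> s \<xi> * twisted_deriv (h a) s \<xi>) + ?W (Suc a) \<xi> * (\<omega> s \<xi> * h a s \<xi>)))
        (at \<xi>)"
      by (intro has_vector_derivative_sum has_vector_derivative_mult has_deriv_rescaled W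
          phase_mult_deriv[OF h] s)
    then have "nth_deriv (Suc m) (\<lambda>\<xi>. of_real (W (s * (\<xi> + \<gamma>))) * (\<omega> s \<xi> * Q s \<xi>)) \<xi> =
        (\<Sum>a\<le>m. ?W a \<xi> * (\<omega> s \<xi> * twisted_deriv (h a) s \<xi>))
        + (\<Sum>a\<le>m. ?W (Suc a) \<xi> * (\<omega> s \<xi> * h a s \<xi>))"
      unfolding nth_deriv_Suc deriv[OF W s] by (simp only: vector_derivative_at sum.distrib)
    also have "(\<Sum>a\<le>m. ?W a \<xi> * (\<omega> s \<xi> * twisted_deriv (h a) s \<xi>)) =
        (\<Sum>a\<le>Suc m. ?W a \<xi> * (\<omega> s \<xi> * (if a \<le> m then twisted_deriv (h a) s \<xi> else 0)))"
      by simp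
    also have "(\<Sum>a\<le>m. ?W (Suc a) \<xi> * (\<omega> s \<xi> * h a s \<xi>)) =
        (\<Sum>a\<le>Suc m. ?W a \<xi> * (\<omega> s \<xi> * (if a = 0 then 0 else h (a - 1) s \<xi>)))"
      by (simp only: sum.atMost_Suc_shift) simp
    finally show "nth_deriv (Suc m) (\<lambda>\<xi>. of_real (W (s * (\<xi> + \<gamma>))) * (\<omega> s \<xi> * Q s \<xi>)) \<xi> =
        (\<Sum>a\<le>Suc m. ?W a \<xi> * (\<omega> s \<xi> * h' a s \<xi>))"
      by (simp only: h'_def distrib_left sum.distrib)
  qed
  ultimately show ?case by (intro exI[of _ h'] conjI allI impI)
qed

lemma quintic_phase_mult:
  fixes v :: complex
  shows "of_real (1 / s\<^sup>2 * w * (cmod (\<omega> s \<xi> * v)) ^ 4) * (\<omega> s \<xi> * v) =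
    of_real w * (\<omega> s \<xi> * (1 * of_real (1 / s ^ 2) * of_real (ln s ^ 0) * (v * cnj v * (v * cnj v) * v)))"
proof -
  have "complex_of_real ((cmod v) ^ 4) = of_real ((cmod v)\<^sup>2) * of_real ((cmod v)\<^sup>2)"
    unfolding of_real_mult[symmetric] by (simp add: power_add[symmetric])
  then have "complex_of_real ((cmod (\<omega> s \<xi> * v)) ^ 4) = v * cnj v * (v * cnj v)"
    by (simp only: norm_mult norm_phase mult_1 complex_norm_square)
  then show ?thesis
    unfolding of_real_mult by (simp only: of_real_1 power_0 mult_1 mult_1_right mult_ac)
qed

text \<open>The only information on the potential that enters is the bound \<open>M s^(-q)\<close> for its rescaled derivatives
  on \<open>S\<close>. Power decay, Schwartz decay and the absence of a potential are three ways to
  supply \<open>M\<close> and \<open>q\<close>, with the same \<open>E\<close> and \<open>d\<close>.\<close>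

lemma residual_bound:
  assumes V: "V \<in> expansions S 0" and res: "reduced_residual V \<in> expansions S (n + 2)"
  shows "\<exists>E>0. \<exists>d. \<forall>W \<gamma> q M s. smooth W \<and> M \<ge> 0 \<and> s \<ge> 1 \<and>
      (\<forall>a\<le>m. \<forall>\<xi>\<in>S. \<bar>s ^ a * nth_deriv a W (s * (\<xi> + \<gamma>))\<bar> \<le> M * s powr (- q)) \<longrightarrow>
    L2_bounded (nth_deriv m (residual \<beta> \<gamma> W (\<lambda>s \<xi>. \<omega> s \<xi> * V s \<xi>) s))
      (E * (1 + M) * (s powr (- real n - 2) + s powr (- q - 2)) * (1 + ln s) ^ d)"
proof -
  define Q where "Q = (\<lambda>s \<xi>. 1 * of_real (1 / s ^ 2) * of_real (ln s ^ 0) *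
    (V s \<xi> * cnj (V s \<xi>) * (V s \<xi> * cnj (V s \<xi>)) * V s \<xi>))"
  have "(\<lambda>s \<xi>. V s \<xi> * cnj (V s \<xi>) * (V s \<xi> * cnj (V s \<xi>)) * V s \<xi>) \<in> expansions S (0 + 0 + (0 + 0) + 0)"
    by (intro expansions_mult expansions_cnj V)
  from expansions_factor[OF this, of 1 2 0] have Q: "Q \<in> expansions S 2"
    unfolding Q_def by simp
  obtain h where h: "\<And>a. h a \<in> expansions S 2" and
    deriv: "\<And>W \<gamma> s. smooth W \<Longrightarrow> s > 0 \<Longrightarrow>
      nth_deriv m (\<lambda>\<xi>. of_real (W (s * (\<xi> + \<gamma>))) * (\<omega> s \<xi> * Q s \<xi>)) =
      (\<lambda>\<xi>. \<Sum>a\<le>m. of_real (s ^ a * nth_deriv a W (s * (\<xi> + \<gamma>))) * (\<omega> s \<xi> * h a s \<xi>))"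
    using nth_deriv_potential_mult[OF Q] by blast
  from expansions_bound[OF twisted_deriv_power_expansions[OF res] compact, of m]
  obtain C1 d1 where C1: "C1 \<ge> 0" "\<forall>s\<ge>1. \<forall>\<xi>.
      cmod ((twisted_deriv ^^ m) (reduced_residual V) s \<xi>) \<le> C1 * (1 / s ^ (n + 2)) * (1 + ln s) ^ d1"
    by (elim exE conjE) (rule that)
  from expansions_family_bound[where h = h and m = m, OF h compact]
  obtain C2 d2 where C2: "C2 \<ge> 0" "\<forall>a\<le>m. \<forall>s\<ge>1. \<forall>\<xi>.
      cmod (h a s \<xi>) \<le> C2 * (1 / s ^ 2) * (1 + ln s) ^ d2"
    by (elim exE conjE) (rule that)
  define C where "C = C1 + real (Suc m) * C2 + 1"
  define d where "d = max d1 d2"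
  define E where "E = C * (1 + sqrt (measure lborel S))"
  have "C > 0" using C1 C2 by (simp add: C_def add_nonneg_pos)
  then have "E > 0" by (simp add: E_def add_pos_nonneg)
  have "L2_bounded (nth_deriv m (residual \<beta> \<gamma> W (\<lambda>s \<xi>. \<omega> s \<xi> * V s \<xi>) s))
      (E * (1 + M) * (s powr (- real n - 2) + s powr (- q - 2)) * (1 + ln s) ^ d)"
    if W: "smooth W" and M: "M \<ge> 0" and s: "s \<ge> 1"
      and small: "\<And>a \<xi>. a \<le> m \<Longrightarrow> \<xi> \<in> S \<Longrightarrow> \<bar>s ^ a * nth_deriv a W (s * (\<xi> + \<gamma>))\<bar> \<le> M * s powr (- q)"
    for W \<gamma> q M s
  proof -
    have s0: "s > 0" using s by simp
    let ?r = "\<lambda>\<xi>. \<omega> s \<xi> * reduced_residual V s \<xi>"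
    let ?w = "\<lambda>\<xi>. of_real (W (s * (\<xi> + \<gamma>))) * (\<omega> s \<xi> * Q s \<xi>)"
    let ?R = "residual \<beta> \<gamma> W (\<lambda>s \<xi>. \<omega> s \<xi> * V s \<xi>) s"
    let ?B = "C * (1 + M) * (s powr (- real n - 2) + s powr (- q - 2)) * (1 + ln s) ^ d"
    have R: "?R = (\<lambda>\<xi>. ?r \<xi> + ?w \<xi>)"
      unfolding residual_def residual0_phase_mult[OF V s] quintic_phase_mult Q_def ..
    have smooth_r: "smooth ?r" and smooth_w: "smooth ?w"
      by (rule smooth_phase_mult[OF res s0])
         (rule smooth_mult[OF smooth_rescaled[OF W] smooth_phase_mult[OF Q s0]])
    have R_deriv: "nth_deriv m ?R \<xi> = \<omega> s \<xi> * (twisted_deriv ^^ m) (reduced_residual V) s \<xi>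
        + (\<Sum>a\<le>m. of_real (s ^ a * nth_deriv a W (s * (\<xi> + \<gamma>))) * (\<omega> s \<xi> * h a s \<xi>))" for \<xi>
      unfolding R nth_deriv_sum[OF smooth_r smooth_w] nth_deriv_phase_mult[OF res s0]
        deriv[OF W s0] ..
    have outside: "nth_deriv m ?R \<xi> = 0" if "\<xi> \<notin> S" for \<xi>
      using expansions_outside[OF twisted_deriv_power_expansions[OF res] s0 that]
        expansions_outside[OF h s0 that] by (simp add: R_deriv)
    have log: "(1 + ln s) ^ d1 \<le> (1 + ln s) ^ d" "(1 + ln s) ^ d2 \<le> (1 + ln s) ^ d"
      using s by (auto simp: d_def intro!: power_increasing)
    have pow: "1 / s ^ (n + 2) = s powr (- real n - 2)" "s powr (- q) * (1 / s ^ 2) = s powr (- q - 2)"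
      using s0 by (simp_all add: powr_diff powr_minus powr_realpow power_add divide_inverse
          power2_eq_square)
    have bound: "cmod (nth_deriv m ?R \<xi>) \<le> ?B" for \<xi>
    proof (cases "\<xi> \<in> S")
      case True
      have main: "cmod (\<omega> s \<xi> * (twisted_deriv ^^ m) (reduced_residual V) s \<xi>) \<le>
          C1 * s powr (- real n - 2) * (1 + ln s) ^ d"
      proof -
        have "C1 * (1 / s ^ (n + 2)) * (1 + ln s) ^ d1 \<le> C1 * (1 / s ^ (n + 2)) * (1 + ln s) ^ d"
          by (rule mult_left_mono[OF log(1)]) (use C1(1) s in simp)
        from order_trans[OF C1(2)[rule_format, OF s, of \<xi>] this] show ?thesis
          unfolding norm_mult norm_phase mult_1 pow .
      qed
      have "cmod (\<Sum>a\<le>m. of_real (s ^ a * nth_deriv a W (s * (\<xi> + \<gamma>))) * (\<omega> s \<xi> * h a s \<xi>))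
          \<le> (\<Sum>a\<le>m. M * s powr (- q) * (C2 * (1 / s ^ 2) * (1 + ln s) ^ d))"
      proof (rule order_trans[OF norm_sum], rule sum_mono)
        fix a assume "a \<in> {..m}"
        then have a: "a \<le> m" by simp
        have "C2 * (1 / s ^ 2) * (1 + ln s) ^ d2 \<le> C2 * (1 / s ^ 2) * (1 + ln s) ^ d"
          by (rule mult_left_mono[OF log(2)]) (use C2 in simp)
        then have "cmod (h a s \<xi>) \<le> C2 * (1 / s ^ 2) * (1 + ln s) ^ d"
          using C2(2)[rule_format, OF a s, of \<xi>] by linarith
        with small[OF a True] show "cmod (of_real (s ^ a * nth_deriv a W (s * (\<xi> + \<gamma>))) * (\<omega> s \<xi> * h a s \<xi>))
            \<le> M * s powr (- q) * (C2 * (1 / s ^ 2) * (1 + ln s) ^ d)"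
          unfolding norm_mult norm_phase norm_of_real mult_1 by (intro mult_mono) (use M in auto)
      qed
      also have "\<dots> = real (Suc m) * C2 * M * (s powr (- q) * (1 / s ^ 2)) * (1 + ln s) ^ d"
        by simp
      finally have pot: "cmod (\<Sum>a\<le>m. of_real (s ^ a * nth_deriv a W (s * (\<xi> + \<gamma>))) * (\<omega> s \<xi> * h a s \<xi>))
          \<le> real (Suc m) * C2 * M * s powr (- q - 2) * (1 + ln s) ^ d"
        unfolding pow .
      have coeff: "C1 \<le> C * (1 + M)" "real (Suc m) * C2 * M \<le> C * (1 + M)"
      proof -
        have "C1 * 1 \<le> C * (1 + M)" "real (Suc m) * C2 * M \<le> C * (1 + M)"
          using C1 C2 M by (intro mult_mono; simp add: C_def)+
        then show "C1 \<le> C * (1 + M)" "real (Suc m) * C2 * M \<le> C * (1 + M)" by simp_all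
      qed
      have "cmod (nth_deriv m ?R \<xi>) \<le> C1 * s powr (- real n - 2) * (1 + ln s) ^ d
          + real (Suc m) * C2 * M * s powr (- q - 2) * (1 + ln s) ^ d"
        unfolding R_deriv by (rule order_trans[OF norm_triangle_ineq add_mono[OF main pot]])
      also have "\<dots> \<le> C * (1 + M) * s powr (- real n - 2) * (1 + ln s) ^ d
          + C * (1 + M) * s powr (- q - 2) * (1 + ln s) ^ d"
        using coeff s by (intro add_mono mult_right_mono) auto
      finally show ?thesis by (simp add: distrib_left distrib_right)
    next
      case False
      show ?thesis
        using outside[OF False] \<open>C > 0\<close> M s by simp
    qed
    have "continuous_on UNIV (nth_deriv m ?R)"
      unfolding R by (intro smooth_continuous smooth_nth_deriv smooth_add smooth_r smooth_w)
    from L2_bounded_of_sup_bound[OF this compact outside bound]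
    have "L2_bounded (nth_deriv m ?R) (?B * sqrt (measure lborel S))" .
    moreover have "?B * sqrt (measure lborel S) \<le> ?B * (1 + sqrt (measure lborel S))"
      using order_trans[OF norm_ge_zero bound] by (intro mult_left_mono) auto
    moreover have "?B * (1 + sqrt (measure lborel S)) =
        E * (1 + M) * (s powr (- real n - 2) + s powr (- q - 2)) * (1 + ln s) ^ d"
      by (simp only: E_def mult_ac)
    ultimately show ?thesis
      unfolding L2_bounded_def by linarith
  qed
  with \<open>E > 0\<close> show ?thesis
    by (intro exI[of _ E] conjI exI[of _ d] allI impI; (elim conjE)?) simp_all
qed

end

lemma separated_imp_uniform:
  assumes "separated K (- \<gamma>)"
  obtains \<delta> where "\<delta> > 0" "\<And>\<xi>. \<xi> \<in> K \<Longrightarrow> \<delta> \<le> \<bar>\<xi> + \<gamma>\<bar>"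
proof (cases "K = {}")
  case False
  then have "setdist K {- \<gamma>} > 0" using assms by (simp add: separated_def)
  moreover have "setdist K {- \<gamma>} \<le> \<bar>\<xi> + \<gamma>\<bar>" if "\<xi> \<in> K" for \<xi>
    using setdist_le_dist[OF that, of "- \<gamma>" "{- \<gamma>}"] by (simp add: dist_real_def)
  ultimately show ?thesis using that by blast
qed (use that[of 1] in simp)

text \<open>Away from the origin each derivative of \<open>W\<close> gains a factor \<open>(s \<delta>)^(-1)\<close>, which cancels the \<open>s\<close> produced by the
  chain rule.\<close>

lemma decaying_potential_rescaled:
  assumes "decaying_potential p W" "\<delta> > 0"
  shows "\<exists>M\<ge>0. \<forall>s\<ge>1. \<forall>a\<le>m. \<forall>x. \<delta> \<le> \<bar>x\<bar> \<longrightarrow> \<bar>s ^ a * nth_deriv a W (s * x)\<bar> \<le> M * s powr (- p)"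
proof -
  have p: "p > 2" using assms by (simp add: decaying_potential_def)
  have "\<forall>j. \<exists>C. C > 0 \<and> (\<forall>x. \<bar>nth_deriv j W x\<bar> \<le> C * japanese x powr (- p - real j))"
    using assms(1) unfolding decaying_potential_def by blast
  then obtain C where C: "\<And>j. C j > 0"
    "\<And>j x. \<bar>nth_deriv j W x\<bar> \<le> C j * japanese x powr (- p - real j)" by metis
  let ?c = "\<lambda>a. C a * \<delta> powr (- p - real a)"
  have "\<bar>s ^ a * nth_deriv a W (s * x)\<bar> \<le> sum ?c {..m} * s powr (- p)"
    if s: "s \<ge> 1" and a: "a \<le> m" and x: "\<delta> \<le> \<bar>x\<bar>" for s a x
  proof -
    have "s * \<delta> \<le> \<bar>s * x\<bar>" using s x by (simp add: abs_mult)
    also have "\<dots> \<le> japanese (s * x)"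
      unfolding japanese_def by (rule real_le_rsqrt) simp
    finally have "japanese (s * x) powr (- p - real a) \<le> (s * \<delta>) powr (- p - real a)"
      using s assms(2) p by (intro powr_mono2') auto
    then have "\<bar>nth_deriv a W (s * x)\<bar> \<le> C a * (s * \<delta>) powr (- p - real a)"
      using C(2)[of a "s * x"] C(1)[of a] by (meson less_imp_le mult_left_mono order_trans)
    then have "s ^ a * \<bar>nth_deriv a W (s * x)\<bar> \<le> s ^ a * (C a * (s * \<delta>) powr (- p - real a))"
      using s by (intro mult_left_mono) auto
    also have "\<dots> = ?c a * (s ^ a * s powr (- p - real a))"
      using s assms(2) by (simp add: powr_mult mult_ac)
    also have "s ^ a * s powr (- p - real a) = s powr (- p)"
      using s by (simp add: powr_diff powr_realpow)
    also have "?c a * s powr (- p) \<le> sum ?c {..m} * s powr (- p)"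
      using a less_imp_le[OF C(1)] by (intro mult_right_mono member_le_sum) auto
    finally show ?thesis using s by (simp add: abs_mult)
  qed
  moreover have "sum ?c {..m} \<ge> 0" using less_imp_le[OF C(1)] by (intro sum_nonneg) simp
  ultimately show ?thesis by blast
qed

text \<open>The seminorm with weight \<open>x^(r+a)\<close> spends \<open>a\<close> powers on the chain rule and keeps \<open>r \<ge> q\<close> powers of decay. Only
  \<open>m + 1\<close> seminorms occur.\<close>

lemma schwartz_rescaled:
  assumes W: "schwartz W" and \<delta>: "\<delta> > 0" and q: "q \<le> real r" and s: "s \<ge> 1" and a: "a \<le> m"
    and x: "\<delta> \<le> \<bar>x\<bar>"
  shows "\<bar>s ^ a * nth_deriv a W (s * x)\<bar> \<le>
    (\<Sum>a\<le>m. \<bar>schwartz_seminorm W (r + a, a)\<bar> / \<delta> ^ (r + a)) * s powr (- q)"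
proof -
  let ?n = "schwartz_seminorm W (r + a, a)"
  have "bounded (range (\<lambda>x. x ^ (r + a) * nth_deriv a W x))"
    using W by (simp add: schwartz_def)
  then obtain B where "\<And>x. \<bar>x ^ (r + a) * nth_deriv a W x\<bar> \<le> B"
    unfolding bounded_iff by auto
  then have "bdd_above (range (\<lambda>x. \<bar>x ^ (r + a) * nth_deriv a W x\<bar>))"
    by (intro bdd_aboveI2)
  then have "\<bar>(s * x) ^ (r + a) * nth_deriv a W (s * x)\<bar> \<le> ?n"
    unfolding schwartz_seminorm_def prod.case by (intro cSUP_upper[where x = "s * x"]) auto
  then have n: "\<bar>s * x\<bar> ^ (r + a) * \<bar>nth_deriv a W (s * x)\<bar> \<le> \<bar>?n\<bar>"
    by (simp add: abs_mult power_abs)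
  have "(s * \<delta>) ^ (r + a) \<le> \<bar>s * x\<bar> ^ (r + a)"
    using s x \<delta> by (intro power_mono) (auto simp: abs_mult)
  then have "(s * \<delta>) ^ (r + a) * \<bar>nth_deriv a W (s * x)\<bar> \<le> \<bar>?n\<bar>"
    using n by (meson abs_ge_zero mult_right_mono order_trans)
  then have "s ^ a * \<bar>nth_deriv a W (s * x)\<bar> \<le> \<bar>?n\<bar> / \<delta> ^ (r + a) * (1 / s ^ r)"
    using s \<delta> by (simp add: field_simps power_add power_mult_distrib)
  also have "\<dots> \<le> \<bar>?n\<bar> / \<delta> ^ (r + a) * s powr (- q)"
  proof (rule mult_left_mono)
    have "1 / s ^ r = s powr (- real r)"
      using s by (simp add: powr_minus powr_realpow divide_inverse)
    also have "\<dots> \<le> s powr (- q)" using s q by (intro powr_mono) auto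
    finally show "1 / s ^ r \<le> s powr (- q)" .
  qed (use \<delta> in simp)
  also have "\<dots> \<le> (\<Sum>a\<le>m. \<bar>schwartz_seminorm W (r + a, a)\<bar> / \<delta> ^ (r + a)) * s powr (- q)"
    using a \<delta> by (intro mult_right_mono
        member_le_sum[where f = "\<lambda>a. \<bar>schwartz_seminorm W (r + a, a)\<bar> / \<delta> ^ (r + a)"]) auto
  finally show ?thesis using s by (simp add: abs_mult)
qed

section \<open>The approximate solutions\<close>

lemma corrections_of_log_polynomial:
  assumes "p \<in> log_polynomials S" "compact S" "S \<subseteq> K"
  shows "(\<lambda>s \<xi>. phase \<beta> A s \<xi> * of_real (1 / s ^ k) * p (ln s) \<xi>) \<in> corrections \<beta> A K k"
proof -
  obtain J c where p: "p = (\<lambda>l \<xi>. \<Sum>j=0..J. c j \<xi> * of_real (l ^ j))"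
    and c: "\<And>j. c j \<in> supported_smooth S"
    using assms(1) by (auto simp: log_polynomials_def)
  have "\<forall>j\<le>J. c j \<in> test_functions \<and> tsupp (c j) \<subseteq> K"
    using supported_smooth_imp_test_function[OF assms(2) c] assms(3) by blast
  then show ?thesis unfolding corrections_def p by blast
qed

lemma residual_zero_potential: "residual \<beta> \<gamma> (\<lambda>_. 0) U = residual0 \<beta> U"
  by (simp add: residual_def fun_eq_iff)

lemma nth_deriv_zero: "nth_deriv m (\<lambda>_. 0) = (\<lambda>_. 0)"
  using nth_deriv_of_sequence[where F = "\<lambda>_ _. 0" and m = m] by simp

context profile
begin

lemma residual0_bound:
  assumes V: "V \<in> expansions S 0" and res: "reduced_residual V \<in> expansions S (n + 2)"
  shows "\<exists>C>0. \<exists>d. \<forall>s\<ge>1.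
    L2_bounded (nth_deriv m (residual0 \<beta> (\<lambda>s \<xi>. \<omega> s \<xi> * V s \<xi>) s))
      (C * s powr (- real n - 2) * (1 + ln s) ^ d)"
proof -
  from residual_bound[OF assms, of m] obtain E d where "E > 0" and
    E: "\<forall>W \<gamma> q M s. smooth W \<and> M \<ge> 0 \<and> s \<ge> 1 \<and>
      (\<forall>a\<le>m. \<forall>\<xi>\<in>S. \<bar>s ^ a * nth_deriv a W (s * (\<xi> + \<gamma>))\<bar> \<le> M * s powr (- q)) \<longrightarrow>
    L2_bounded (nth_deriv m (residual \<beta> \<gamma> W (\<lambda>s \<xi>. \<omega> s \<xi> * V s \<xi>) s))
      (E * (1 + M) * (s powr (- real n - 2) + s powr (- q - 2)) * (1 + ln s) ^ d)"
    by (elim exE conjE) (rule that)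
  have "L2_bounded (nth_deriv m (residual0 \<beta> (\<lambda>s \<xi>. \<omega> s \<xi> * V s \<xi>) s))
      (2 * E * s powr (- real n - 2) * (1 + ln s) ^ d)" if "s \<ge> 1" for s
    \<comment> \<open>With \<open>q = n\<close> both powers of \<open>s\<close> coincide, which accounts for the factor \<open>2\<close>.\<close>
    using E[rule_format, of "\<lambda>_. 0" 0 s 0 "real n"] that smooth_const[of 0]
    by (simp add: residual_zero_potential nth_deriv_zero mult_ac)
  with \<open>E > 0\<close> show ?thesis by (intro exI[of _ "2 * E"] exI[of _ d]) auto
qed

lemma residual_bound_decaying_schwartz:
  assumes V: "V \<in> expansions S 0" and res: "reduced_residual V \<in> expansions S (n + 2)"
    and \<gamma>: "separated S (- \<gamma>)"
  shows "\<exists>d::nat.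
      (\<forall>p W. decaying_potential p W \<longrightarrow> (\<exists>C>0. \<forall>s\<ge>1.
         L2_bounded (nth_deriv m (residual \<beta> \<gamma> W (\<lambda>s \<xi>. \<omega> s \<xi> * V s \<xi>) s))
           (C * (s powr (- real n - 2) + s powr (- p - 2)) * (1 + ln s) ^ d)))
      \<and> (\<forall>q>0. \<exists>F. finite F \<and> (\<exists>C :: (nat \<times> nat \<Rightarrow> real) \<Rightarrow> real.
           (\<forall>v. C v > 0) \<and>
           (\<forall>W. schwartz W \<longrightarrow> (\<forall>s\<ge>1.
             L2_bounded (nth_deriv m (residual \<beta> \<gamma> W (\<lambda>s \<xi>. \<omega> s \<xi> * V s \<xi>) s))
               (C (restrict (schwartz_seminorm W) F)
                  * (s powr (- real n - 2) + s powr (- q - 2)) * (1 + ln s) ^ d)))))"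
proof -
  from residual_bound[OF V res, of m] obtain E d where "E > 0" and
    E: "\<forall>W \<gamma> q M s. smooth W \<and> M \<ge> 0 \<and> s \<ge> 1 \<and>
      (\<forall>a\<le>m. \<forall>\<xi>\<in>S. \<bar>s ^ a * nth_deriv a W (s * (\<xi> + \<gamma>))\<bar> \<le> M * s powr (- q)) \<longrightarrow>
    L2_bounded (nth_deriv m (residual \<beta> \<gamma> W (\<lambda>s \<xi>. \<omega> s \<xi> * V s \<xi>) s))
      (E * (1 + M) * (s powr (- real n - 2) + s powr (- q - 2)) * (1 + ln s) ^ d)"
    by (elim exE conjE) (rule that)
  obtain \<delta> where \<delta>: "\<delta> > 0" "\<And>\<xi>. \<xi> \<in> S \<Longrightarrow> \<delta> \<le> \<bar>\<xi> + \<gamma>\<bar>"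
    using separated_imp_uniform[OF \<gamma>] by blast
  show ?thesis
  proof (intro exI[of _ d] conjI allI impI)
    fix p W assume W: "decaying_potential p W"
    from decaying_potential_rescaled[OF W \<delta>(1), of m] obtain M where M: "M \<ge> 0"
      "\<forall>s\<ge>1. \<forall>a\<le>m. \<forall>x. \<delta> \<le> \<bar>x\<bar> \<longrightarrow> \<bar>s ^ a * nth_deriv a W (s * x)\<bar> \<le> M * s powr (- p)"
      by (elim exE conjE) (rule that)
    show "\<exists>C>0. \<forall>s\<ge>1.
         L2_bounded (nth_deriv m (residual \<beta> \<gamma> W (\<lambda>s \<xi>. \<omega> s \<xi> * V s \<xi>) s))
           (C * (s powr (- real n - 2) + s powr (- p - 2)) * (1 + ln s) ^ d)"
    proof (intro exI[of _ "E * (1 + M)"] conjI allI impI)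
      show "E * (1 + M) > 0" using \<open>E > 0\<close> M(1) by simp
      fix s :: real assume "s \<ge> 1"
      then show "L2_bounded (nth_deriv m (residual \<beta> \<gamma> W (\<lambda>s \<xi>. \<omega> s \<xi> * V s \<xi>) s))
           (E * (1 + M) * (s powr (- real n - 2) + s powr (- p - 2)) * (1 + ln s) ^ d)"
        using W M \<delta>(2) by (intro E[rule_format]) (auto simp: decaying_potential_def)
    qed
  next
    fix q :: real assume "q > 0"
    define r where "r = nat \<lceil>q\<rceil>"
    have r: "q \<le> real r" unfolding r_def by (rule real_nat_ceiling_ge)
    let ?F = "(\<lambda>a. (r + a, a)) ` {..m}"
    let ?M = "\<lambda>v :: nat \<times> nat \<Rightarrow> real. \<Sum>a\<le>m. \<bar>v (r + a, a)\<bar> / \<delta> ^ (r + a)"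
    have M: "?M v \<ge> 0" for v using \<delta>(1) by (intro sum_nonneg) simp
    show "\<exists>F. finite F \<and> (\<exists>C :: (nat \<times> nat \<Rightarrow> real) \<Rightarrow> real.
           (\<forall>v. C v > 0) \<and>
           (\<forall>W. schwartz W \<longrightarrow> (\<forall>s\<ge>1.
             L2_bounded (nth_deriv m (residual \<beta> \<gamma> W (\<lambda>s \<xi>. \<omega> s \<xi> * V s \<xi>) s))
               (C (restrict (schwartz_seminorm W) F)
                  * (s powr (- real n - 2) + s powr (- q - 2)) * (1 + ln s) ^ d))))"
    proof (intro exI[of _ ?F] exI[of _ "\<lambda>v. E * (1 + ?M v)"] conjI allI impI)
      show "E * (1 + ?M v) > 0" for v using \<open>E > 0\<close> M[of v] by simp
      fix W and s :: real assume W: "schwartz W" and s: "s \<ge> 1"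
      have "?M (restrict (schwartz_seminorm W) ?F) = ?M (schwartz_seminorm W)"
        by (intro sum.cong) auto
      moreover have "L2_bounded (nth_deriv m (residual \<beta> \<gamma> W (\<lambda>s \<xi>. \<omega> s \<xi> * V s \<xi>) s))
           (E * (1 + ?M (schwartz_seminorm W)) * (s powr (- real n - 2) + s powr (- q - 2)) * (1 + ln s) ^ d)"
      proof (intro E[rule_format] conjI allI impI ballI)
        show "smooth W" using W by (simp add: schwartz_def)
        fix a \<xi> assume "a \<le> m" "\<xi> \<in> S"
        then show "\<bar>s ^ a * nth_deriv a W (s * (\<xi> + \<gamma>))\<bar> \<le> ?M (schwartz_seminorm W) * s powr (- q)"
          by (intro schwartz_rescaled[OF W \<delta>(1) r s] \<delta>(2))
      qed (use M s in auto)
      ultimately show "L2_bounded (nth_deriv m (residual \<beta> \<gamma> W (\<lambda>s \<xi>. \<omega> s \<xi> * V s \<xi>) s))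
          (E * (1 + ?M (restrict (schwartz_seminorm W) ?F))
            * (s powr (- real n - 2) + s powr (- q - 2)) * (1 + ln s) ^ d)"
        by presburger
    qed simp
  qed
qed

end

lemma separated_subset:
  assumes "separated K x" "S \<subseteq> K"
  shows "separated S x"
  unfolding separated_def
proof (rule disjCI)
  assume "\<not> setdist S {x} > 0"
  show "S = {}"
  proof (rule ccontr)
    assume "S \<noteq> {}"
    then have "setdist K {x} \<le> setdist S {x}" "K \<noteq> {}"
      using setdist_subset_left[of S K "{x}"] assms(2) by auto
    with assms(1) \<open>\<not> setdist S {x} > 0\<close> show False by (simp add: separated_def)
  qed
qed

theorem proposition5p4:
  fixes \<beta> :: real and A :: "real \<Rightarrow> complex"
  assumes "A \<in> test_functions"
  shows "\<exists>\<phi> :: nat \<Rightarrow> real \<Rightarrow> real \<Rightarrow> complex.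
    \<forall>K. compact K \<and> tsupp A \<subseteq> interior K \<longrightarrow> (\<forall>N\<ge>1.
      (\<forall>k\<in>{1..N}. \<phi> k \<in> corrections \<beta> A K k)
      \<and> (\<forall>m. \<exists>C>0. \<exists>d::nat. \<forall>s\<ge>1.
            L2_bounded (nth_deriv m (residual0 \<beta> (approx \<beta> A \<phi> N) s))
              (C * s powr (- real N - 2) * (1 + ln s) ^ d))
      \<and> (\<forall>\<gamma>. separated K (- \<gamma>) \<longrightarrow> (\<forall>m. \<exists>d::nat.
            (\<forall>p W. decaying_potential p W \<longrightarrow> (\<exists>C>0. \<forall>s\<ge>1.
               L2_bounded (nth_deriv m (residual \<beta> \<gamma> W (approx \<beta> A \<phi> N) s))
                 (C * (s powr (- real N - 2) + s powr (- p - 2)) * (1 + ln s) ^ d)))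
            \<and> (\<forall>q>0. \<exists>F. finite F \<and> (\<exists>C :: (nat \<times> nat \<Rightarrow> real) \<Rightarrow> real.
                 (\<forall>v. C v > 0) \<and>
                 (\<forall>W. schwartz W \<longrightarrow> (\<forall>s\<ge>1.
                   L2_bounded (nth_deriv m (residual \<beta> \<gamma> W (approx \<beta> A \<phi> N) s))
                     (C (restrict (schwartz_seminorm W) F)
                        * (s powr (- real N - 2) + s powr (- q - 2)) * (1 + ln s) ^ d))))))))"
proof -
  interpret profile \<beta> A "tsupp A"
    using assms test_function_supported_smooth[OF assms]
    by unfold_locales (simp_all add: test_functions_def)
  from approximate_solutions obtain P where
    P: "\<forall>n. P n \<in> log_polynomials (tsupp A) \<and>
      (let V = (\<lambda>s \<xi>. A \<xi> + (\<Sum>k=1..n. of_real (1 / s ^ k) * P k (ln s) \<xi>))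
       in V \<in> expansions (tsupp A) 0 \<and> reduced_residual V \<in> expansions (tsupp A) (Suc (Suc n)))"
    by (rule exE)
  define V where "V n = (\<lambda>s \<xi>. A \<xi> + (\<Sum>k=1..n. of_real (1 / s ^ k) * P k (ln s) \<xi>))" for n
  have V: "V n \<in> expansions (tsupp A) 0" "reduced_residual (V n) \<in> expansions (tsupp A) (n + 2)" for n
    using P[rule_format, of n] by (simp_all add: V_def Let_def)
  \<comment> \<open>The coefficients come from \<open>\<beta>\<close> and \<open>A\<close> alone and are supported in \<open>tsupp A\<close>, so one choice serves all \<open>K\<close> and all \<open>N\<close>.\<close>
  define \<phi> where "\<phi> k = (\<lambda>s \<xi>. \<omega> s \<xi> * of_real (1 / s ^ k) * P k (ln s) \<xi>)" for k
  have approx: "approx \<beta> A \<phi> N = (\<lambda>s \<xi>. \<omega> s \<xi> * V N s \<xi>)" for N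
    by (simp add: approx_def leading_def \<phi>_def V_def fun_eq_iff sum_distrib_left distrib_left mult.assoc)
  show ?thesis
  proof (rule exI[of _ \<phi>], intro allI impI, unfold approx, intro conjI allI impI ballI)
    fix K N
    assume K: "compact K \<and> tsupp A \<subseteq> interior K"
    then have sub: "tsupp A \<subseteq> K" using interior_subset by blast
    show "\<phi> k \<in> corrections \<beta> A K k" for k
      unfolding \<phi>_def using P[rule_format, of k] sub compact
      by (intro corrections_of_log_polynomial) auto
    show "\<exists>C>0. \<exists>d. \<forall>s\<ge>1. L2_bounded (nth_deriv m (residual0 \<beta> (\<lambda>s \<xi>. \<omega> s \<xi> * V N s \<xi>) s))
        (C * s powr (- real N - 2) * (1 + ln s) ^ d)" for m
      by (rule residual0_bound[OF V])
    fix \<gamma> m assume "separated K (- \<gamma>)"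
    then have "separated (tsupp A) (- \<gamma>)" using sub by (rule separated_subset)
    note residual_bound_decaying_schwartz[OF V this]
    then show "\<exists>d::nat.
      (\<forall>p W. decaying_potential p W \<longrightarrow> (\<exists>C>0. \<forall>s\<ge>1.
         L2_bounded (nth_deriv m (residual \<beta> \<gamma> W (\<lambda>s \<xi>. \<omega> s \<xi> * V N s \<xi>) s))
           (C * (s powr (- real N - 2) + s powr (- p - 2)) * (1 + ln s) ^ d)))
      \<and> (\<forall>q>0. \<exists>F. finite F \<and> (\<exists>C :: (nat \<times> nat \<Rightarrow> real) \<Rightarrow> real.
           (\<forall>v. C v > 0) \<and>
           (\<forall>W. schwartz W \<longrightarrow> (\<forall>s\<ge>1.
             L2_bounded (nth_deriv m (residual \<beta> \<gamma> W (\<lambda>s \<xi>. \<omega> s \<xi> * V N s \<xi>) s))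
               (C (restrict (schwartz_seminorm W) F)
                  * (s powr (- real N - 2) + s powr (- q - 2)) * (1 + ln s) ^ d)))))" .
  qed
qed

end
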